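(* Let $d(m)$ denote the number of divisors of $m$, and define $p_n$ for $n\geq 1$ by $\sum_{n\geq 0}p_nz^n=\prod_{m=1}^{\infty}(1-z^m)^{-d(m)}$ (i.e. $p_n$ is the number of generalized partitions of $n$). For $m\geq -1$ and $\omega\in(0,\infty)$ let $$S_m(\omega)=\sum_{k\geq 1}\sum_{\ell\mid k}\ell\, d(\ell)\,k^m e^{-k/\omega}.$$ Then, as $n\to\infty$, $$p_n\sim\frac{1}{\sqrt{2\pi S_1(\omega)}}\exp\left(S_{-1}(\omega)+\frac{n}{\omega}\right),$$ where $\omega=\omega(n)$ is the unique solution in $(0,\infty)$ of $S_0(\omega)=n$, and $a_n\sim b_n$ means $\lim_{n\to\infty}a_n/b_n=1$.
   Context: A generalized partition of $n$ is a finite nonempty multiset of pairs $(v_i,w_i)$ of positive integers with $\sum_i v_iw_i=n$. *)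

theory Defs
  imports "HOL-Analysis.Analysis" "HOL-Library.Multiset"
    "HOL-Computational_Algebra.Formal_Power_Series"
begin

definition num_divisors :: "nat \<Rightarrow> nat" where
  "num_divisors m = card {k. k dvd m}"

definition generalized_partitions :: "nat \<Rightarrow> (nat \<times> nat) multiset set" where
  "generalized_partitions n =
    {P. P \<noteq> {#} \<and> (\<forall>(v, w) \<in># P. v > 0 \<and> w > 0) \<and> (\<Sum>(v, w)\<in>#P. v * w) = n}"

text \<open>
  The infinite product is taken in the usual (coefficientwise) topology on formal power
  series; the index is shifted because \<^const>\<open>prodinf\<close> starts at 0.
\<close>

definition gp_series :: "real fps" where
  "gp_series = (\<Prod>i. inverse ((1 - fps_X ^ Suc i) ^ num_divisors (Suc i)))"

definition gp_coeff :: "nat \<Rightarrow> real" where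
  "gp_coeff n = fps_nth gp_series n"

definition S :: "int \<Rightarrow> real \<Rightarrow> real" where
  "S m \<omega> = (\<Sum>\<^sub>\<infinity>k\<in>{1::nat..}. \<Sum>l | l dvd k.
      real l * real (num_divisors l) * real k powi m * exp (- real k / \<omega>))"

definition omega :: "nat \<Rightarrow> real" where
  "omega n = (THE \<omega>. \<omega> > 0 \<and> S 0 \<omega> = real n)"

end

theory Submission
  imports Defs "HOL-Complex_Analysis.Complex_Analysis" "HOL-Probability.Probability"
    "HOL-Real_Asymp.Real_Asymp"
begin

text \<open>
  Write \<open>F(z) = \<Sum> p\<^sub>n z\<^sup>n = exp (\<Sum> b\<^sub>k z\<^sup>k)\<close> with \<open>k b\<^sub>k = \<Sum>\<^bsub>l | k\<^esub> l d(l)\<close>. By Cauchy's formula on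
  the circle of radius \<open>r = exp (-1/\<omega>)\<close>, the quotient of \<open>p\<^sub>n\<close> by the claimed asymptotic value is
  \<open>sqrt (S\<^sub>1 / 2\<pi>)\<close> times the integral over \<open>[-\<pi>, \<pi>]\<close> of \<open>F(r e\<^bsup>it\<^esup>) / F(r) e\<^bsup>-int\<^esup>\<close>. As \<open>S\<^sub>0(\<omega>) = n\<close>, the
  logarithm of the integrand is \<open>-S\<^sub>1 t\<^sup>2 / 2\<close> up to an error \<open>S\<^sub>2 \<bar>t\<bar>\<^sup>3 / 6\<close>, so dominated convergence
  yields a Gaussian integral for small \<open>t\<close>. For the other \<open>t\<close>, \<open>b\<^sub>k \<ge> 1\<close> bounds the modulus of the
  integrand by the one belonging to \<open>\<Sum> z\<^sup>k\<close>, which is explicitly and exponentially small. The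
  polynomial bounds \<open>1 \<le> b\<^sub>k \<le> k\<^sup>2\<close> suffice throughout, because every estimate has a power of \<open>\<omega>\<close> to
  spare.
\<close>

section \<open>Elementary estimates\<close>

text \<open>One term of the exponential series is at most the whole sum, since all its terms are
  nonnegative.\<close>

lemma power_mult_exp_minus_le:
  fixes x :: real
  assumes "x \<ge> 0"
  shows "x ^ p * exp (- x) \<le> fact p"
proof -
  have "(\<Sum>n\<in>{p}. x ^ n /\<^sub>R fact n) \<le> exp x"
    unfolding exp_def by (rule sum_le_suminf) (use assms summable_exp_generic[of x] in auto)
  then have "x ^ p \<le> fact p * exp x"
    by (simp add: field_simps)
  then show ?thesis
    by (simp add: exp_minus field_simps)
qed

lemma power_mult_exp_minus_mult_le:
  fixes s :: real
  assumes "s > 0"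
  shows "real k ^ p * exp (- real k * s) \<le> fact p / s ^ p"
  using power_mult_exp_minus_le[of "real k * s" p] assms by (simp add: power_mult_distrib field_simps)

text \<open>The cubic Taylor remainder gives \<open>1 - cos x \<ge> x^2 / 2 - x^3 / 6\<close>; on
  the unit interval \<open>x^3 \<le> x^2\<close>, and \<open>1/2 - 1/6 = 1/3\<close>.\<close>

lemma one_minus_cos_ge:
  fixes x :: real
  assumes "0 \<le> x" "x \<le> 1"
  shows "x\<^sup>2 / 3 \<le> 1 - cos x"
proof -
  have eq: "Re (iexp x - (\<Sum>k\<le>2. (\<i> * x) ^ k / fact k)) = cos x - 1 + x\<^sup>2 / 2"
    by (simp add: eval_nat_numeral Re_exp)
  have "\<bar>cos x - 1 + x\<^sup>2 / 2\<bar> \<le> \<bar>x\<bar> ^ 3 / 6"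
    using order_trans[OF abs_Re_le_cmod iexp_approx1[of x 2]] unfolding eq by (simp add: eval_nat_numeral)
  moreover have "x ^ 3 \<le> x\<^sup>2"
    using assms by (intro power_decreasing) auto
  moreover have "\<bar>x\<bar> = x" using assms by simp
  ultimately show ?thesis by linarith
qed

text \<open>The real part of the geometric series in \<open>z = r * cis t\<close> is subtracted from
  the geometric series in \<open>r\<close>. The second factor of the denominator is the squared
  modulus of \<open>1 - z\<close>.\<close>

lemma sums_geometric_one_minus_cos:
  fixes r t :: real
  assumes "0 < r" "r < 1"
  shows "(\<lambda>k. r ^ k * (1 - cos (real k * t))) sums
    (r * (1 + r) * (1 - cos t) / ((1 - r) * ((1 - r)\<^sup>2 + 2 * r * (1 - cos t))))"
proof -
  define z where "z = of_real r * cis t"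
  have "norm z < 1"
    using assms by (simp add: z_def norm_mult)
  then have "(\<lambda>k. Re (z ^ k)) sums Re (1 / (1 - z))"
    by (intro sums_Re geometric_sums)
  moreover have "Re (z ^ k) = r ^ k * cos (real k * t)" for k
    by (simp add: z_def power_mult_distrib Complex.DeMoivre del: of_real_power flip: of_real_power)
  moreover have "Re (1 / (1 - z)) = (1 - r * cos t) / ((1 - r)\<^sup>2 + 2 * r * (1 - cos t))"
  proof -
    have "(1 - r * cos t)\<^sup>2 + (r * sin t)\<^sup>2 = 1 - 2 * r * cos t + r\<^sup>2 * ((sin t)\<^sup>2 + (cos t)\<^sup>2)"
      by algebra
    also have "\<dots> = (1 - r)\<^sup>2 + 2 * r * (1 - cos t)"
      unfolding sin_cos_squared_add by (simp add: power2_eq_square algebra_simps)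
    finally show ?thesis
      by (simp add: z_def Re_divide)
  qed
  ultimately have "(\<lambda>k. r ^ k * cos (real k * t)) sums
      ((1 - r * cos t) / ((1 - r)\<^sup>2 + 2 * r * (1 - cos t)))"
    by simp
  from sums_diff[OF geometric_sums[of r] this]
  have "(\<lambda>k. r ^ k * (1 - cos (real k * t))) sums
      (1 / (1 - r) - (1 - r * cos t) / ((1 - r)\<^sup>2 + 2 * r * (1 - cos t)))"
    using assms by (simp add: algebra_simps)
  also have "1 / (1 - r) - (1 - r * cos t) / ((1 - r)\<^sup>2 + 2 * r * (1 - cos t)) =
      r * (1 + r) * (1 - cos t) / ((1 - r) * ((1 - r)\<^sup>2 + 2 * r * (1 - cos t)))"
  proof -
    have "(1 - r)\<^sup>2 > 0" "2 * r * (1 - cos t) \<ge> 0"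
      using assms by simp_all
    then have nz: "(1 - r)\<^sup>2 + 2 * r * (1 - cos t) \<noteq> 0" "1 - r \<noteq> 0"
      using assms by linarith+
    show ?thesis
      using nz by (simp add: divide_simps) (simp add: power2_eq_square algebra_simps)
  qed
  finally show ?thesis .
qed

lemma integral_exp_minus_square_half:
  "integral\<^sup>L lborel (\<lambda>x::real. exp (- x\<^sup>2 / 2)) = sqrt (2 * pi)"
  using integral_std_normal_moment_even[of 0] by (simp add: std_normal_density_def)

text \<open>Up to the factor \<open>sqrt (4 * pi)\<close> this is the normal density of variance 2.
  It serves as the majorant for dominated convergence.\<close>

lemma integrable_exp_minus_square_quarter:
  "integrable lborel (\<lambda>x::real. exp (- x\<^sup>2 / 4))"
proof -
  have "integrable lborel (\<lambda>x::real. sqrt (4 * pi) * (normal_density 0 (sqrt 2) x * (x - 0) ^ 0))"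
    by (intro integrable_mult_right integrable_normal_moment) simp
  then show ?thesis by (simp add: normal_density_def)
qed

lemma iexp_minus_linear_le: "cmod (iexp x - 1 - \<i> * of_real x) \<le> x\<^sup>2 / 2"
proof -
  have "(\<Sum>k\<le>1. (\<i> * of_real x) ^ k / fact k) = 1 + \<i> * of_real x"
    by simp
  then show ?thesis
    using iexp_approx1[of x 1] by (simp add: diff_diff_eq power2_eq_square)
qed

lemma iexp_minus_quadratic_le:
  "cmod (iexp x - 1 - \<i> * of_real x + of_real (x\<^sup>2 / 2)) \<le> \<bar>x\<bar> ^ 3 / 6"
proof -
  have "(\<Sum>k\<le>2. (\<i> * of_real x) ^ k / fact k) = 1 + \<i> * of_real x - of_real (x\<^sup>2 / 2)"
    by (simp add: eval_nat_numeral algebra_simps)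
  then show ?thesis
    using iexp_approx1[of x 2] by (simp add: algebra_simps eval_nat_numeral)
qed

lemma summable_inverse_squares: "summable (\<lambda>k. inverse (real k ^ 2))"
  by (rule inverse_power_summable) simp

section \<open>The saddle point method for exponentials of power series\<close>

text \<open>
  The coefficients of \<open>log F\<close>. The only property of the divisor function that enters the
  analysis is this pair of bounds.
\<close>

locale saddle_point_coeffs =
  fixes b :: "nat \<Rightarrow> real"
  assumes b_0: "b 0 = 0"
    and b_ge: "\<And>k. k > 0 \<Longrightarrow> 1 \<le> b k"
    and b_le: "\<And>k. b k \<le> real k ^ 2"
begin

lemma b_nonneg: "0 \<le> b k"
  using b_0 b_ge[of k] by (cases "k = 0") auto

text \<open>In the application, \<open>S\<^sub>m(\<omega>)\<close> is \<open>L (m + 1) (1 / \<omega>)\<close>.\<close>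

definition L :: "nat \<Rightarrow> real \<Rightarrow> real" where
  "L j s = (\<Sum>k. real k ^ j * b k * exp (- real k * s))"

text \<open>This is zeta(2), since \<open>inverse 0 = 0\<close> removes the term at 0.\<close>

definition C :: real where
  "C = (\<Sum>k. inverse (real k ^ 2))"

lemma C_nonneg: "0 \<le> C"
  unfolding C_def by (intro suminf_nonneg summable_inverse_squares) simp

lemma L_term_nonneg: "0 \<le> real k ^ j * b k * exp (- real k * s)"
  using b_nonneg by simp

text \<open>Splitting off \<open>inverse (real k ^ 2)\<close> leaves a pure power for the
  exponential to absorb and a summable factor.\<close>

lemma power_mult_b_le: "real k ^ j * b k \<le> real k ^ (j + 4) * inverse (real k ^ 2)"
proof (cases "k = 0")
  case False
  have "real k ^ j * b k \<le> real k ^ j * real k ^ 2"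
    by (intro mult_left_mono b_le) simp
  also have "\<dots> = real k ^ (j + 4) * inverse (real k ^ 2)"
    using False by (simp add: field_simps power_add eval_nat_numeral)
  finally show ?thesis .
qed (simp add: b_0)

lemma L_term_le:
  assumes "s > 0"
  shows "real k ^ j * b k * exp (- real k * s) \<le> fact (j + 4) / s ^ (j + 4) * inverse (real k ^ 2)"
proof -
  have "real k ^ j * b k * exp (- real k * s)
      \<le> real k ^ (j + 4) * inverse (real k ^ 2) * exp (- real k * s)"
    by (intro mult_right_mono power_mult_b_le) simp
  also have "\<dots> = (real k ^ (j + 4) * exp (- real k * s)) * inverse (real k ^ 2)"
    by simp
  also have "\<dots> \<le> fact (j + 4) / s ^ (j + 4) * inverse (real k ^ 2)"
    by (intro mult_right_mono power_mult_exp_minus_mult_le assms) simp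
  finally show ?thesis .
qed

lemma summable_L:
  assumes "s > 0"
  shows "summable (\<lambda>k. real k ^ j * b k * exp (- real k * s))"
proof (rule summable_comparison_test')
  show "summable (\<lambda>k. fact (j + 4) / s ^ (j + 4) * inverse (real k ^ 2))"
    by (intro summable_mult summable_inverse_squares)
  show "norm (real k ^ j * b k * exp (- real k * s))
      \<le> fact (j + 4) / s ^ (j + 4) * inverse (real k ^ 2)" for k
    using L_term_le[OF assms, of k j] L_term_nonneg[of k j s] by simp
qed

lemma L_le:
  assumes "s > 0"
  shows "L j s \<le> fact (j + 4) / s ^ (j + 4) * C"
  unfolding L_def C_def suminf_mult[OF summable_inverse_squares, symmetric]
  by (intro suminf_le summable_L L_term_le summable_mult summable_inverse_squares assms)

text \<open>About \<open>1 / s\<close> indices near \<open>1 / s\<close> already suffice: each of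
  the \<open>N\<close> terms with \<open>N \<le> k < 2 * N\<close> is at least
  \<open>N ^ 2 * exp (- 4)\<close>, because \<open>k * s \<le> 2 * N * s \<le> 4\<close>.\<close>

lemma L_2_ge:
  assumes "0 < s" "s \<le> 1"
  shows "exp (- 4) / s ^ 3 \<le> L 2 s"
proof -
  define N where "N = nat \<lceil>1 / s\<rceil>"
  have N: "1 / s \<le> real N" "real N \<le> 1 / s + 1"
    using assms unfolding N_def by (auto intro!: real_nat_ceiling_ge simp: of_nat_ceiling)
  then have Ns: "real N * s \<le> 2"
    using assms mult_right_mono[OF N(2), of s] by (simp add: field_simps)
  have "exp (- 4) / s ^ 3 = (1 / s) ^ 3 * exp (- 4)"
    by (simp add: field_simps)
  also have "\<dots> \<le> real N ^ 3 * exp (- 4)"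
    using N assms by (intro mult_right_mono power_mono) auto
  also have "\<dots> = (\<Sum>k\<in>{N..<2*N}. real N ^ 2 * 1 * exp (- 4))"
    by (simp add: eval_nat_numeral)
  also have "\<dots> \<le> (\<Sum>k\<in>{N..<2*N}. real k ^ 2 * b k * exp (- real k * s))"
  proof (rule sum_mono, intro mult_mono)
    fix k assume k: "k \<in> {N..<2*N}"
    have "real k * s \<le> (2 * real N) * s"
      using k assms by (intro mult_right_mono) auto
    then show "exp (- 4) \<le> exp (- real k * s)"
      using Ns by simp
    show "1 \<le> b k" using k by (intro b_ge) auto
    show "real N ^ 2 \<le> real k ^ 2" using k by (intro power_mono) auto
  qed (use b_nonneg in auto)
  also have "\<dots> \<le> L 2 s"
    unfolding L_def by (intro sum_le_suminf summable_L assms ballI L_term_nonneg) auto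
  finally show ?thesis .
qed

text \<open>Split at \<open>k = K\<close>. Below, one factor \<open>k\<close> is replaced by
  \<open>K\<close>. Above, half of the exponential decay absorbs \<open>k ^ 7\<close> and the other
  half yields \<open>exp (- K * s / 2)\<close>. Adding both bounds gives one majorant for every
  \<open>k\<close>.\<close>

lemma L_3_le:
  assumes "s > 0" "K > 0"
  shows "L 3 s \<le> K * L 2 s + fact 7 / (s / 2) ^ 7 * exp (- K * s / 2) * C"
proof -
  let ?D = "fact 7 / (s / 2) ^ 7 * exp (- K * s / 2)"
  have le: "real k ^ 3 * b k * exp (- real k * s)
      \<le> K * (real k ^ 2 * b k * exp (- real k * s)) + ?D * inverse (real k ^ 2)" for k
  proof (cases "real k \<le> K")
    case True
    have "real k ^ 3 * b k * exp (- real k * s) = real k * (real k ^ 2 * b k * exp (- real k * s))"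
      by (simp add: eval_nat_numeral)
    also have "\<dots> \<le> K * (real k ^ 2 * b k * exp (- real k * s))"
      using True by (intro mult_right_mono L_term_nonneg)
    also have "\<dots> \<le> K * (real k ^ 2 * b k * exp (- real k * s)) + ?D * inverse (real k ^ 2)"
      using assms by simp
    finally show ?thesis .
  next
    case False
    have "real k ^ 3 * b k * exp (- real k * s)
        \<le> real k ^ 7 * inverse (real k ^ 2) * exp (- real k * s)"
      using power_mult_b_le[of k 3] by (intro mult_right_mono) auto
    also have "\<dots> = (real k ^ 7 * exp (- real k * (s / 2))) * exp (- real k * s / 2) * inverse (real k ^ 2)"
    proof -
      have "exp (- real k * s) = exp (- real k * (s / 2)) * exp (- real k * s / 2)"
        by (simp flip: exp_add)
      then show ?thesis by simp
    qed
    also have "\<dots> \<le> ?D * inverse (real k ^ 2)"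
    proof (intro mult_right_mono mult_mono power_mult_exp_minus_mult_le)
      show "exp (- real k * s / 2) \<le> exp (- K * s / 2)"
        using False assms by simp
    qed (use assms in auto)
    also have "\<dots> \<le> K * (real k ^ 2 * b k * exp (- real k * s)) + ?D * inverse (real k ^ 2)"
      using assms L_term_nonneg[of k 2 s] by simp
    finally show ?thesis .
  qed
  have "L 3 s \<le> (\<Sum>k. K * (real k ^ 2 * b k * exp (- real k * s)) + ?D * inverse (real k ^ 2))"
    unfolding L_def
    by (intro suminf_le le summable_add summable_mult summable_L summable_inverse_squares assms)
  also have "\<dots> = (\<Sum>k. K * (real k ^ 2 * b k * exp (- real k * s))) + (\<Sum>k. ?D * inverse (real k ^ 2))"
    by (intro suminf_add[symmetric] summable_mult summable_L summable_inverse_squares assms)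
  also have "\<dots> = K * L 2 s + ?D * C"
    unfolding L_def C_def
    by (simp only: suminf_mult[OF summable_L[OF assms(1)]] suminf_mult[OF summable_inverse_squares])
  finally show ?thesis .
qed

section \<open>The exponent of the normalised Cauchy integrand\<close>

text \<open>
  \<open>H s t = log (F(r e\<^bsup>it\<^esup>) / F(r)) - i t (L 1 s)\<close> with \<open>r = exp (-s)\<close>; at the saddle point
  \<open>L 1 s = n\<close>, so that \<open>exp (H s t)\<close> is the normalised Cauchy integrand.
\<close>

definition H :: "real \<Rightarrow> real \<Rightarrow> complex" where
  "H s t = (\<Sum>k. of_real (b k * exp (- real k * s)) * (iexp (real k * t) - 1 - \<i> * of_real (real k * t)))"

lemma summable_H:
  assumes "s > 0"
  shows "summable (\<lambda>k. of_real (b k * exp (- real k * s)) *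
    (iexp (real k * t) - 1 - \<i> * of_real (real k * t)))" (is "summable ?f")
proof (rule summable_comparison_test')
  show "summable (\<lambda>k. t\<^sup>2 / 2 * (real k ^ 2 * b k * exp (- real k * s)))"
    by (intro summable_mult summable_L assms)
  show "norm (?f k) \<le> t\<^sup>2 / 2 * (real k ^ 2 * b k * exp (- real k * s))" for k
  proof -
    have "norm (?f k) \<le> (b k * exp (- real k * s)) * ((real k * t)\<^sup>2 / 2)"
      unfolding norm_mult using b_nonneg[of k]
      by (intro mult_mono iexp_minus_linear_le) (auto simp: norm_mult)
    then show ?thesis by (simp add: power_mult_distrib mult_ac)
  qed
qed

text \<open>Second-order Taylor expansion of every \<open>iexp (k * t)\<close>: the quadratic terms
  sum to a multiple of \<open>L 2 s\<close>, the cubic remainders to a multiple of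
  \<open>L 3 s\<close>.\<close>

lemma H_approx:
  assumes "s > 0"
  shows "cmod (H s t + of_real (L 2 s * t\<^sup>2 / 2)) \<le> L 3 s * \<bar>t\<bar> ^ 3 / 6"
proof -
  let ?f = "\<lambda>k. of_real (b k * exp (- real k * s)) * (iexp (real k * t) - 1 - \<i> * of_real (real k * t))"
  let ?g = "\<lambda>k. of_real (t\<^sup>2 / 2 * (real k ^ 2 * b k * exp (- real k * s))) :: complex"
  have "(\<lambda>k. t\<^sup>2 / 2 * (real k ^ 2 * b k * exp (- real k * s))) sums (t\<^sup>2 / 2 * L 2 s)"
    unfolding L_def by (intro sums_mult summable_sums summable_L assms)
  then have "?g sums of_real (t\<^sup>2 / 2 * L 2 s)"
    by (rule sums_of_real)
  moreover have "?f sums H s t"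
    unfolding H_def by (intro summable_sums summable_H assms)
  ultimately have sums: "(\<lambda>k. ?f k + ?g k) sums (H s t + of_real (L 2 s * t\<^sup>2 / 2))"
    by (auto dest: sums_add simp: mult_ac)
  have le: "norm (?f k + ?g k) \<le> \<bar>t\<bar> ^ 3 / 6 * (real k ^ 3 * b k * exp (- real k * s))" for k
  proof -
    have "?f k + ?g k = of_real (b k * exp (- real k * s)) *
        (iexp (real k * t) - 1 - \<i> * of_real (real k * t) + of_real ((real k * t)\<^sup>2 / 2))"
      by (simp add: power_mult_distrib algebra_simps)
    also have "norm \<dots> \<le> (b k * exp (- real k * s)) * (\<bar>real k * t\<bar> ^ 3 / 6)"
      unfolding norm_mult using b_nonneg[of k]
      by (intro mult_mono iexp_minus_quadratic_le) (auto simp: norm_mult)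
    finally show ?thesis by (simp add: power_mult_distrib abs_mult mult_ac)
  qed
  have "norm (\<Sum>k. ?f k + ?g k) \<le> (\<Sum>k. \<bar>t\<bar> ^ 3 / 6 * (real k ^ 3 * b k * exp (- real k * s)))"
    by (intro norm_suminf_le le summable_mult summable_L assms)
  also have "\<dots> = \<bar>t\<bar> ^ 3 / 6 * L 3 s"
    unfolding L_def by (intro suminf_mult summable_L assms)
  finally show ?thesis
    using sums_unique[OF sums] by (simp add: mult_ac)
qed

text \<open>
  All coefficients are at least 1, so comparison with the geometric series suffices; its closed
  form is uniform in \<open>t\<close> and needs no arithmetic information.
\<close>

lemma Re_H_le:
  assumes "s > 0"
  defines "r \<equiv> exp (- s)"
  shows "Re (H s t) \<le> - (r * (1 + r) * (1 - cos t) / ((1 - r) * ((1 - r)\<^sup>2 + 2 * r * (1 - cos t))))"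
proof -
  let ?f = "\<lambda>k. of_real (b k * exp (- real k * s)) * (iexp (real k * t) - 1 - \<i> * of_real (real k * t))"
  have r: "0 < r" "r < 1" using assms by (auto simp: r_def)
  have "(\<lambda>k. Re (?f k)) sums Re (H s t)"
    unfolding H_def by (intro sums_Re summable_sums summable_H assms)
  moreover have "(\<lambda>k. - (r ^ k * (1 - cos (real k * t)))) sums
     - (r * (1 + r) * (1 - cos t) / ((1 - r) * ((1 - r)\<^sup>2 + 2 * r * (1 - cos t))))"
    by (intro sums_minus sums_geometric_one_minus_cos r)
  moreover have "Re (?f k) \<le> - (r ^ k * (1 - cos (real k * t)))" for k
  proof (cases "k = 0")
    case False
    have rk: "exp (- real k * s) = r ^ k"
      by (simp add: r_def flip: exp_of_nat_mult)
    have "Re (?f k) = - (b k * (r ^ k * (1 - cos (real k * t))))"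
      unfolding rk by (simp add: Re_exp algebra_simps)
    moreover have "1 * (r ^ k * (1 - cos (real k * t))) \<le> b k * (r ^ k * (1 - cos (real k * t)))"
      using b_ge[of k] False r by (intro mult_right_mono) auto
    ultimately show ?thesis by linarith
  qed (simp add: b_0)
  ultimately show ?thesis
    by (rule sums_le[rotated])
qed

section \<open>Cauchy's formula for the coefficients of the exponential series\<close>

definition G :: "complex fps" where
  "G = Abs_fps (\<lambda>k. of_real (b k))"

text \<open>At a point \<open>r = exp (- s)\<close> of the unit interval the series is the one of
  \<open>L 0 s\<close>, which converges.\<close>

lemma fps_conv_radius_G: "fps_conv_radius G \<ge> 1"
  unfolding fps_conv_radius_def
proof (rule conv_radius_geI_ex)
  fix r :: real assume r: "0 < r" "ereal r < 1"
  define s where "s = - ln r"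
  have s: "s > 0" "r = exp (- s)"
    using r by (auto simp: s_def)
  have "summable (\<lambda>k. complex_of_real (real k ^ 0 * b k * exp (- real k * s)))"
    by (intro summable_of_real summable_L s)
  moreover have "exp (- real k * s) = r ^ k" for k
    by (simp add: s(2) flip: exp_of_nat_mult)
  ultimately have "summable (\<lambda>k. fps_nth G k * of_real r ^ k)"
    by (simp add: G_def)
  then show "\<exists>z. norm z = r \<and> summable (\<lambda>n. fps_nth G n * z ^ n)"
    using r by (intro exI[of _ "of_real r"]) auto
qed

lemma in_eball_G: "norm z < 1 \<Longrightarrow> z \<in> eball 0 (fps_conv_radius G)"
  using fps_conv_radius_G by (auto simp: eball_def intro: less_le_trans[of _ 1])

lemma holomorphic_eval_G: "eval_fps G holomorphic_on ball 0 1"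
  by (intro holomorphic_on_eval_fps) (use in_eball_G in auto)

text \<open>The three parts of the summand converge separately. This closed form ties
  \<open>H\<close> to a holomorphic function, giving continuity in \<open>t\<close> and access to
  Cauchy's formula.\<close>

lemma H_eq:
  assumes "s > 0"
  shows "H s t = eval_fps G (of_real (exp (- s)) * cis t) - of_real (L 0 s) - \<i> * of_real t * of_real (L 1 s)"
proof -
  define z where "z = of_real (exp (- s)) * cis t"
  have "norm z < 1"
    using assms by (simp add: z_def norm_mult)
  then have "(\<lambda>k. fps_nth G k * z ^ k) sums eval_fps G z"
    using fps_conv_radius_G by (intro sums_eval_fps) (auto intro: less_le_trans[of _ 1])
  moreover have "(\<lambda>k. of_real (real k ^ 0 * b k * exp (- real k * s))) sums (of_real (L 0 s) :: complex)"
    unfolding L_def by (intro sums_of_real summable_sums summable_L assms)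
  moreover have "(\<lambda>k. \<i> * of_real t * of_real (real k ^ 1 * b k * exp (- real k * s))) sums
      (\<i> * of_real t * of_real (L 1 s) :: complex)"
    unfolding L_def by (intro sums_mult sums_of_real summable_sums summable_L assms)
  ultimately have "(\<lambda>k. fps_nth G k * z ^ k - of_real (real k ^ 0 * b k * exp (- real k * s)) -
      \<i> * of_real t * of_real (real k ^ 1 * b k * exp (- real k * s))) sums
      (eval_fps G z - of_real (L 0 s) - \<i> * of_real t * of_real (L 1 s))"
    by (intro sums_diff)
  moreover have "fps_nth G k * z ^ k - of_real (real k ^ 0 * b k * exp (- real k * s)) -
      \<i> * of_real t * of_real (real k ^ 1 * b k * exp (- real k * s)) =
      of_real (b k * exp (- real k * s)) * (iexp (real k * t) - 1 - \<i> * of_real (real k * t))" for k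
  proof -
    have "z ^ k = of_real (exp (- s) ^ k) * cis (real k * t)"
      by (simp add: z_def power_mult_distrib Complex.DeMoivre)
    also have "exp (- s) ^ k = exp (- real k * s)"
      by (simp flip: exp_of_nat_mult)
    finally have "z ^ k = of_real (exp (- real k * s)) * iexp (real k * t)"
      by (simp add: cis_conv_exp)
    then show ?thesis
      by (simp add: G_def algebra_simps)
  qed
  ultimately have "(\<lambda>k. of_real (b k * exp (- real k * s)) *
      (iexp (real k * t) - 1 - \<i> * of_real (real k * t))) sums
      (eval_fps G z - of_real (L 0 s) - \<i> * of_real t * of_real (L 1 s))"
    by (simp only:)
  from sums_unique[OF this] show ?thesis
    unfolding H_def z_def by simp
qed

lemma continuous_H:
  assumes "s > 0"
  shows "continuous_on A (H s)"
  unfolding H_eq[OF assms, abs_def]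
  using assms by (auto intro!: continuous_intros in_eball_G simp: norm_mult)

definition J :: "real \<Rightarrow> complex" where
  "J s = (LINT t:{-pi..pi}|lborel. exp (H s t))"

text \<open>The formal counterpart of \<open>F = exp G\<close>; the composition is meaningful
  because \<open>b 0 = 0\<close>.\<close>

definition E :: "complex fps" where
  "E = fps_compose (fps_exp 1) G"

lemma coeff_E_integral:
  assumes "0 < r" "r < 1"
  shows "((\<lambda>t. exp (eval_fps G (of_real r * cis t)) * cis (- real n * t)) has_integral
    2 * of_real pi * fps_nth E n * of_real r ^ n) {0..2*pi}"
proof -
  let ?F = "\<lambda>z. exp (eval_fps G z)"
  have "fps_nth G 0 = 0" by (simp add: G_def b_0)
  moreover have "fps_conv_radius G > 0"
    using fps_conv_radius_G by (rule less_le_trans[rotated]) simp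
  ultimately have "(exp \<circ> eval_fps G) has_fps_expansion E"
    unfolding E_def by (intro has_fps_expansion_compose has_fps_expansion_exp1) (simp_all add: has_fps_expansion_def)
  then have E: "fps_nth E n = (deriv ^^ n) ?F 0 / fact n"
    by (auto dest: fps_nth_fps_expansion simp: o_def)
  have hol: "?F holomorphic_on ball 0 1"
    by (intro holomorphic_intros holomorphic_eval_G)
  have "((\<lambda>u. ?F u / (u - 0) ^ Suc n) has_contour_integral
      (2 * pi * \<i>) / fact n * (deriv ^^ n) ?F 0) (circlepath 0 r)"
    by (rule Cauchy_has_contour_integral_higher_derivative_circlepath)
       (use assms in \<open>auto intro!: holomorphic_on_imp_continuous_on holomorphic_on_subset[OF hol]\<close>)
  then have "((\<lambda>u. ?F u / u ^ Suc n) has_contour_integral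
      (2 * pi * \<i> * fps_nth E n)) (part_circlepath 0 r 0 (2 * pi))"
    by (simp add: E circlepath_def)
  then have "((\<lambda>t. ?F (0 + r * cis t) / (0 + r * cis t) ^ Suc n * r * \<i> * cis t) has_integral
      2 * pi * \<i> * fps_nth E n) {0..2*pi}"
    by (subst (asm) has_contour_integral_part_circlepath_iff) auto
  \<comment> \<open>This factor cancels the derivative \<open>r * \<i> * cis t\<close> of the path
    against the denominator, up to \<open>cis (- n * t)\<close>.\<close>
  from has_integral_mult_right[OF this, of "of_real r ^ n / \<i>"]
  have "((\<lambda>t. of_real r ^ n / \<i> * (?F (0 + r * cis t) / (0 + r * cis t) ^ Suc n * r * \<i> * cis t)) has_integral
      2 * of_real pi * fps_nth E n * of_real r ^ n) {0..2*pi}"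
    by (simp add: mult_ac)
  moreover have "of_real r ^ n / \<i> * (?F (0 + r * cis t) / (0 + r * cis t) ^ Suc n * r * \<i> * cis t)
      = ?F (r * cis t) * cis (- real n * t)" for t
  proof -
    have "cis (- real n * t) = inverse (cis t ^ n)"
      by (simp add: Complex.DeMoivre)
    then show ?thesis
      using assms by (simp add: power_mult_distrib field_simps)
  qed
  ultimately show ?thesis by simp
qed

text \<open>The peak at \<open>t = 0\<close> has to lie inside the interval of integration, so by
  periodicity the left half is shifted by \<open>2 * pi\<close>.\<close>

lemma coeff_E_integral_symmetric:
  assumes "0 < r" "r < 1"
  shows "integral {-pi..pi} (\<lambda>t. exp (eval_fps G (of_real r * cis t)) * cis (- real n * t)) =
    2 * of_real pi * fps_nth E n * of_real r ^ n"
proof -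
  let ?f = "\<lambda>t. exp (eval_fps G (of_real r * cis t)) * cis (- real n * t)"
  have cont: "continuous_on A ?f" for A
    using assms by (auto intro!: continuous_intros in_eball_G simp: norm_mult)
  have periodic: "?f (t + 2 * pi) = ?f t" for t
  proof -
    have "cis (t + 2 * pi) = cis t" by (simp flip: cis_mult)
    moreover have "cis (- real n * (t + 2 * pi)) = inverse (cis (t + 2 * pi) ^ n)"
      by (simp add: Complex.DeMoivre)
    moreover have "cis (- real n * t) = inverse (cis t ^ n)"
      by (simp add: Complex.DeMoivre)
    ultimately show ?thesis by simp
  qed
  have "integral {-pi..pi} ?f = integral {-pi..0} ?f + integral {0..pi} ?f"
    by (intro Henstock_Kurzweil_Integration.integral_combine[symmetric] integrable_continuous_interval cont) auto
  also have "integral {-pi..0} ?f = integral {pi - 2 * pi..2 * pi - 2 * pi} (\<lambda>t. ?f (t + 2 * pi))"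
    unfolding periodic by simp
  also have "\<dots> = integral {pi..2*pi} ?f"
    by (rule integral_shift_real_ivl)
  also have "\<dots> + integral {0..pi} ?f = integral {0..2*pi} ?f"
    by (subst add.commute, intro Henstock_Kurzweil_Integration.integral_combine integrable_continuous_interval cont) auto
  also have "\<dots> = 2 * of_real pi * fps_nth E n * of_real r ^ n"
    by (intro integral_unique coeff_E_integral assms)
  finally show ?thesis .
qed

text \<open>The condition \<open>L 1 s = n\<close> turns the linear term of \<open>H_eq\<close> into
  the factor \<open>cis (- n * t)\<close> of Cauchy's integrand; the rest is a constant
  factor.\<close>

lemma J_eq:
  assumes "s > 0" "L 1 s = real n"
  shows "J s = 2 * of_real pi * fps_nth E n * of_real (exp (- L 0 s - real n * s))"
proof -
  define r where "r = exp (- s)"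
  have r: "0 < r" "r < 1" using assms by (auto simp: r_def)
  have "continuous_on {-pi..pi} (\<lambda>t. exp (H s t))"
    by (intro continuous_intros continuous_H assms)
  then have "J s = integral {-pi..pi} (\<lambda>t. exp (H s t))"
    unfolding J_def by (intro set_borel_integral_eq_integral borel_integrable_atLeastAtMost')
  also have "(\<lambda>t. exp (H s t)) = (\<lambda>t. of_real (exp (- L 0 s)) *
      (exp (eval_fps G (of_real r * cis t)) * cis (- real n * t)))"
  proof
    fix t
    have "H s t = of_real (- L 0 s) + (eval_fps G (of_real r * cis t) + \<i> * of_real (- real n * t))"
      unfolding H_eq[OF assms(1)] r_def assms(2) by (simp add: algebra_simps)
    then show "exp (H s t) = of_real (exp (- L 0 s)) *
        (exp (eval_fps G (of_real r * cis t)) * cis (- real n * t))"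
      by (simp only: exp_add exp_of_real cis_conv_exp)
  qed
  also have "integral {-pi..pi} \<dots> = of_real (exp (- L 0 s)) *
      integral {-pi..pi} (\<lambda>t. exp (eval_fps G (of_real r * cis t)) * cis (- real n * t))"
    by (rule integral_mult_right)
  also have "\<dots> = of_real (exp (- L 0 s)) * (2 * of_real pi * fps_nth E n * of_real r ^ n)"
    by (simp only: coeff_E_integral_symmetric[OF r])
  also have "\<dots> = 2 * of_real pi * fps_nth E n * of_real (exp (- L 0 s) * r ^ n)"
    by simp
  also have "exp (- L 0 s) * r ^ n = exp (- L 0 s - real n * s)"
    by (simp add: r_def exp_diff exp_minus power_inverse field_simps flip: exp_of_nat_mult)
  finally show ?thesis .
qed

text \<open>Comparing coefficients in \<open>E' = G' * E\<close> yields the recursion assumed for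
  \<open>p\<close>, which determines all values from the first.\<close>

lemma coeff_E_unique:
  assumes "p 0 = 1"
    and "\<And>n. real (Suc n) * p (Suc n) = (\<Sum>i\<le>n. real (Suc i) * b (Suc i) * p (n - i))"
  shows "fps_nth E n = of_real (p n)"
proof (induction n rule: less_induct)
  case (less n)
  have G0: "fps_nth G 0 = 0" by (simp add: G_def b_0)
  show ?case
  proof (cases n)
    case 0
    then show ?thesis by (simp add: E_def assms(1))
  next
    case (Suc m)
    have "fps_deriv E = fps_deriv G * E"
      unfolding E_def by (subst fps_compose_deriv[OF G0]) (simp add: mult.commute)
    then have "fps_nth (fps_deriv E) m = fps_nth (fps_deriv G * E) m"
      by simp
    then have "of_nat (Suc m) * fps_nth E (Suc m) =
        (\<Sum>i\<le>m. of_nat (Suc i) * of_real (b (Suc i)) * fps_nth E (m - i))"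
      by (simp add: fps_mult_nth G_def atLeast0AtMost)
    also have "\<dots> = of_real (\<Sum>i\<le>m. real (Suc i) * b (Suc i) * p (m - i))"
      using less.IH Suc by simp
    also have "\<dots> = of_nat (Suc m) * of_real (p (Suc m))"
      unfolding assms(2)[symmetric] by simp
    finally show ?thesis
      using Suc by (simp del: of_nat_Suc)
  qed
qed

section \<open>Estimates on the central and outer parts of the circle\<close>

text \<open>
  With \<open>s = w\<^sup>-\<^sup>4\<close> all exponents below are integral. The bound is lossy (the true ratio of
  \<open>L 3\<close> to \<open>L 2\<close> has order \<open>w\<^sup>4\<close>), but \<open>w\<^sup>5\<close> still beats \<open>sqrt (L 2)\<close>, which is at least of order
  \<open>w\<^sup>6\<close>.
\<close>

lemma eventually_L_3_le: "\<forall>\<^sub>F w in at_top. L 3 (1 / w ^ 4) \<le> 2 * w ^ 5 * L 2 (1 / w ^ 4)"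
proof -
  have "((\<lambda>w::real. (fact 7 * 2 ^ 7 * C) * (w ^ 28 * exp (- w / 2))) \<longlongrightarrow> (fact 7 * 2 ^ 7 * C) * 0) at_top"
    by (intro tendsto_mult tendsto_const) real_asymp
  then have "\<forall>\<^sub>F w in at_top. (fact 7 * 2 ^ 7 * C) * (w ^ 28 * exp (- w / 2)) < exp (- 4 :: real)"
    by (rule order_tendstoD) simp
  then show ?thesis
    using eventually_ge_at_top[of 1]
  proof eventually_elim
    case (elim w)
    let ?s = "1 / w ^ 4"
    have s: "0 < ?s" "?s \<le> 1" using elim by auto
    have "exp (- 4) \<le> exp (- 4) * w ^ 12"
      using elim by simp
    also have "\<dots> \<le> L 2 ?s"
      using L_2_ge[OF s] by (simp add: power_divide flip: power_mult)
    finally have L2: "exp (- 4) \<le> L 2 ?s" .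
    \<comment> \<open>The cut-off \<open>K = w ^ 5\<close> makes \<open>K * s = w\<close>, so the
      error tends to 0, while \<open>L 2\<close> stays above \<open>exp (- 4)\<close> and can absorb
      it.\<close>
    have "L 3 ?s \<le> w ^ 5 * L 2 ?s + fact 7 / (?s / 2) ^ 7 * exp (- (w ^ 5) * ?s / 2) * C"
      using elim by (intro L_3_le s) simp
    also have "fact 7 / (?s / 2) ^ 7 * exp (- (w ^ 5) * ?s / 2) * C =
        (fact 7 * 2 ^ 7 * C) * (w ^ 28 * exp (- w / 2))"
    proof -
      have "- (w ^ 5) * ?s / 2 = - w / 2"
        using elim by (simp add: eval_nat_numeral)
      then show ?thesis
        by (simp add: power_divide flip: power_mult)
    qed
    finally have "L 3 ?s \<le> w ^ 5 * L 2 ?s + (fact 7 * 2 ^ 7 * C) * (w ^ 28 * exp (- w / 2))" .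
    moreover have "L 2 ?s \<le> w ^ 5 * L 2 ?s"
    proof -
      have "L 2 ?s > 0" using L2 exp_gt_zero[of "-4::real"] by linarith
      moreover have "w ^ 5 \<ge> 1" using elim by simp
      ultimately show ?thesis by simp
    qed
    ultimately show ?case using elim L2 by simp
  qed
qed

lemma sqrt_L_2_ge:
  assumes "w \<ge> 1"
  shows "exp (- 2) * w ^ 6 \<le> sqrt (L 2 (1 / w ^ 4))"
proof (rule real_le_rsqrt)
  have "(exp (- 2) * w ^ 6)\<^sup>2 = exp (- 4) * w ^ 12"
    by (simp add: power_mult_distrib flip: power_mult exp_double)
  also have "\<dots> \<le> L 2 (1 / w ^ 4)"
    using L_2_ge[of "1 / w ^ 4"] assms by (simp add: power_divide flip: power_mult)
  finally show "(exp (- 2) * w ^ 6)\<^sup>2 \<le> L 2 (1 / w ^ 4)" .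
qed

lemma sqrt_L_2_pos:
  assumes "w \<ge> 1"
  shows "sqrt (L 2 (1 / w ^ 4)) > 0"
  by (rule less_le_trans[OF _ sqrt_L_2_ge[OF assms]]) (use assms in simp)

text \<open>Polynomial growth is enough here, as the outer part of the integral carries the factor
  \<open>exp (- (w^2 / 50))\<close>.\<close>

lemma sqrt_L_2_le:
  assumes "w > 0"
  shows "sqrt (L 2 (1 / w ^ 4)) \<le> sqrt (fact 6 * C) * w ^ 12"
proof (rule real_le_lsqrt)
  have "L 2 (1 / w ^ 4) \<le> fact 6 * C * w ^ 24"
    using L_le[of "1 / w ^ 4" 2] assms by (simp add: power_divide mult_ac flip: power_mult)
  also have "\<dots> = (sqrt (fact 6 * C) * w ^ 12)\<^sup>2"
    using C_nonneg by (simp add: power_mult_distrib flip: power_mult)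
  finally show "L 2 (1 / w ^ 4) \<le> (sqrt (fact 6 * C) * w ^ 12)\<^sup>2" .
qed (use assms C_nonneg in simp)

text \<open>For such \<open>t\<close> the cubic error of \<open>H_approx\<close> is at most
  \<open>L 2 * t^2 / 6\<close>, a third of the main term \<open>L 2 * t^2 / 2\<close>.\<close>

lemma Re_H_le_inner:
  assumes w: "w \<ge> 1" and L3: "L 3 (1 / w ^ 4) \<le> 2 * w ^ 5 * L 2 (1 / w ^ 4)"
    and t: "\<bar>t\<bar> \<le> 1 / (2 * w ^ 5)"
  shows "Re (H (1 / w ^ 4) t) \<le> - (L 2 (1 / w ^ 4) * t\<^sup>2 / 4)"
proof -
  let ?s = "1 / w ^ 4"
  have s: "?s > 0" using w by simp
  have L2: "L 2 ?s \<ge> 0"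
    unfolding L_def by (intro suminf_nonneg summable_L s L_term_nonneg)
  have "Re (H ?s t) + L 2 ?s * t\<^sup>2 / 2 \<le> cmod (H ?s t + of_real (L 2 ?s * t\<^sup>2 / 2))"
    using complex_Re_le_cmod[of "H ?s t + of_real (L 2 ?s * t\<^sup>2 / 2)"] by simp
  also have "\<dots> \<le> L 3 ?s * \<bar>t\<bar> ^ 3 / 6"
    by (rule H_approx[OF s])
  also have "\<dots> \<le> (2 * w ^ 5 * L 2 ?s) * \<bar>t\<bar> ^ 3 / 6"
    using L3 by (intro divide_right_mono mult_right_mono) auto
  also have "\<dots> = (2 * w ^ 5 * \<bar>t\<bar>) * (L 2 ?s * t\<^sup>2 / 6)"
    by (simp add: eval_nat_numeral)
  also have "\<dots> \<le> 1 * (L 2 ?s * t\<^sup>2 / 6)"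
    using t w L2 by (intro mult_right_mono) (auto simp: field_simps)
  finally have "Re (H ?s t) \<le> - (L 2 ?s * t\<^sup>2 / 2) + L 2 ?s * t\<^sup>2 / 6" by simp
  also have "\<dots> \<le> - (L 2 ?s * t\<^sup>2 / 4)"
    using L2 by (simp add: field_simps)
  finally show ?thesis .
qed

text \<open>The bound of \<open>Re_H_le\<close> is essentially \<open>u / (s * (s^2 + u))\<close>.
  With \<open>u\<close> at least of order \<open>w^(-10)\<close> and \<open>s = w^(-4)\<close>, this
  is at least of order \<open>w^2\<close>.\<close>

lemma Re_H_le_outer:
  assumes w: "w \<ge> 1" and t: "1 / (2 * w ^ 5) \<le> \<bar>t\<bar>" "\<bar>t\<bar> \<le> pi"
  shows "Re (H (1 / w ^ 4) t) \<le> - (w\<^sup>2 / 50)"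
proof -
  define s where "s = 1 / w ^ 4"
  define d where "d = 1 / (2 * w ^ 5)"
  define r where "r = exp (- s)"
  define u where "u = 2 * r * (1 - cos t)"
  have w5: "w ^ 5 \<ge> 1" using w by simp
  have s: "0 < s" "s \<le> 1" using w by (auto simp: s_def)
  have r: "0 < r" "r < 1" using s by (auto simp: r_def)
  have r_ge: "r \<ge> 1 / 4"
  proof -
    have "exp (1::real) \<le> 4" using exp_le by linarith
    then have "1 / 4 \<le> exp (- 1 :: real)" by (simp add: exp_minus field_simps)
    also have "\<dots> \<le> r" using s by (simp add: r_def)
    finally show ?thesis .
  qed
  have rs: "1 - r \<le> s" using exp_ge_add_one_self[of "- s"] by (simp add: r_def)
  have "2 * w ^ 5 \<ge> 1" using w5 by linarith
  then have d: "0 \<le> d" "d \<le> 1"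
    using w by (simp_all add: d_def divide_le_eq_1)
  \<comment> \<open>By monotonicity of the cosine the worst case is
    \<open>\<bar>t\<bar> = d\<close>.\<close>
  have "cos t = cos \<bar>t\<bar>" by simp
  also have "\<dots> \<le> cos d"
    using t d unfolding d_def[symmetric] by (intro cos_monotone_0_pi_le) auto
  finally have "d\<^sup>2 / 3 \<le> 1 - cos t"
    using one_minus_cos_ge[OF d] by linarith
  then have "2 * (1 / 4) * (d\<^sup>2 / 3) \<le> u"
    unfolding u_def using r_ge by (intro mult_mono) auto
  moreover have "2 * (1 / 4) * (d\<^sup>2 / 3) = 1 / (24 * w ^ 10)"
    by (simp add: d_def power_divide power_mult_distrib flip: power_mult)
  ultimately have u: "1 / (24 * w ^ 10) \<le> u" by simp
  have upos: "u > 0" using u w by (intro less_le_trans[OF _ u]) simp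
  \<comment> \<open>The two summands contribute at most \<open>24 * u\<close> and \<open>u\<close>,
    and \<open>25 / 50 = 1 / 2\<close>.\<close>
  have "w\<^sup>2 / 50 * (s * (s\<^sup>2 + u)) \<le> 1 / 2 * u"
  proof -
    have "w\<^sup>2 * (s * s\<^sup>2) = 1 / w ^ 10"
      using w by (simp add: s_def field_simps eval_nat_numeral)
    also have "\<dots> \<le> 24 * u" using u by simp
    finally have 1: "w\<^sup>2 * (s * s\<^sup>2) \<le> 24 * u" .
    have "w\<^sup>2 * s = 1 / w\<^sup>2"
      using w by (simp add: s_def field_simps eval_nat_numeral)
    also have "\<dots> \<le> 1" using w by simp
    finally have "w\<^sup>2 * s * u \<le> 1 * u"
      using upos by (intro mult_right_mono) auto
    with 1 show ?thesis by (simp add: algebra_simps)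
  qed
  then have "w\<^sup>2 / 50 \<le> 1 / 2 * u / (s * (s\<^sup>2 + u))"
    using s upos by (subst pos_le_divide_eq) (auto intro!: mult_pos_pos add_pos_pos)
  also have "\<dots> \<le> (1 + r) / 2 * u / ((1 - r) * ((1 - r)\<^sup>2 + u))"
    using r rs s upos
    by (intro frac_le mult_mono add_mono power_mono mult_pos_pos add_pos_pos mult_right_mono) auto
  also have "\<dots> = r * (1 + r) * (1 - cos t) / ((1 - r) * ((1 - r)\<^sup>2 + 2 * r * (1 - cos t)))"
    by (simp add: u_def)
  finally show ?thesis
    using Re_H_le[OF s(1), of t] unfolding r_def s_def by linarith
qed

text \<open>
  The part \<open>\<bar>t\<bar> \<le> 1 / (2 w\<^sup>5)\<close> of the Cauchy integrand, rescaled by \<open>x = t sqrt (L 2 s)\<close>. The guard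
  \<open>w \<ge> 1\<close> makes it measurable for every \<open>w\<close>, as dominated convergence along \<open>at_top\<close> demands.
\<close>

definition central_integrand :: "real \<Rightarrow> real \<Rightarrow> complex" where
  "central_integrand w x = (if w \<ge> 1 \<and> \<bar>x\<bar> \<le> sqrt (L 2 (1 / w ^ 4)) / (2 * w ^ 5)
     then exp (H (1 / w ^ 4) (x / sqrt (L 2 (1 / w ^ 4)))) else 0)"

lemma central_integrand_measurable: "central_integrand w \<in> borel_measurable lborel"
proof (cases "w \<ge> 1")
  case True
  let ?g = "\<lambda>x. exp (H (1 / w ^ 4) (x / sqrt (L 2 (1 / w ^ 4))))"
  have "continuous_on UNIV ?g"
    using True sqrt_L_2_pos[OF True]
    by (intro continuous_on_exp continuous_on_compose2[OF continuous_H[of _ UNIV]] continuous_intros) auto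
  then have [measurable]: "?g \<in> borel_measurable borel"
    by (rule borel_measurable_continuous_onI)
  have "(\<lambda>x. if \<bar>x\<bar> \<le> sqrt (L 2 (1 / w ^ 4)) / (2 * w ^ 5) then ?g x else 0) \<in> borel_measurable borel"
    by measurable
  then show ?thesis using True by (simp add: central_integrand_def[abs_def])
qed (simp add: central_integrand_def[abs_def])

text \<open>After rescaling, the error of \<open>H_approx\<close> is at most a multiple of
  \<open>w ^ 5 / sqrt (L 2)\<close>, hence of \<open>1 / w\<close>. The cut-off for \<open>x\<close>
  grows at least linearly in \<open>w\<close>, so a fixed \<open>x\<close> eventually falls inside
  it.\<close>

lemma central_integrand_tendsto: "((\<lambda>w. central_integrand w x) \<longlongrightarrow> of_real (exp (- x\<^sup>2 / 2))) at_top"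
proof -
  let ?z = "\<lambda>w. H (1 / w ^ 4) (x / sqrt (L 2 (1 / w ^ 4)))"
  have "\<forall>\<^sub>F w in at_top. norm (?z w - of_real (- x\<^sup>2 / 2)) \<le> exp 2 * \<bar>x\<bar> ^ 3 / 3 * (1 / w)"
    using eventually_L_3_le eventually_ge_at_top[of 1]
  proof eventually_elim
    case (elim w)
    let ?s = "1 / w ^ 4" let ?\<sigma> = "sqrt (L 2 (1 / w ^ 4))"
    have s: "?s > 0" using elim by simp
    have \<sigma>: "exp (- 2) * w ^ 6 \<le> ?\<sigma>" using elim by (intro sqrt_L_2_ge)
    have \<sigma>_pos: "?\<sigma> > 0" using elim by (intro sqrt_L_2_pos)
    then have L2: "L 2 ?s = ?\<sigma>\<^sup>2" by simp
    have "norm (?z w - of_real (- x\<^sup>2 / 2)) = norm (?z w + of_real (L 2 ?s * (x / ?\<sigma>)\<^sup>2 / 2))"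
      using \<sigma>_pos by (subst (3) L2) (simp add: power_divide)
    also have "\<dots> \<le> L 3 ?s * \<bar>x / ?\<sigma>\<bar> ^ 3 / 6"
      by (rule H_approx[OF s])
    also have "\<dots> \<le> (2 * w ^ 5 * L 2 ?s) * \<bar>x / ?\<sigma>\<bar> ^ 3 / 6"
      using elim by (intro divide_right_mono mult_right_mono) auto
    also have "\<dots> = \<bar>x\<bar> ^ 3 / 3 * w ^ 5 / ?\<sigma>"
      using \<sigma>_pos by (subst (1) L2) (simp add: power_divide abs_mult eval_nat_numeral)
    also have "\<dots> \<le> \<bar>x\<bar> ^ 3 / 3 * w ^ 5 / (exp (- 2) * w ^ 6)"
      using elim \<sigma> by (intro divide_left_mono mult_pos_pos \<sigma>_pos) auto
    also have "\<dots> = exp 2 * \<bar>x\<bar> ^ 3 / 3 * (1 / w)"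
      using elim by (simp add: exp_minus field_simps eval_nat_numeral)
    finally show ?case .
  qed
  moreover have "((\<lambda>w::real. exp 2 * \<bar>x\<bar> ^ 3 / 3 * (1 / w)) \<longlongrightarrow> 0) at_top"
    by (intro tendsto_mult_right_zero) real_asymp
  ultimately have "((\<lambda>w. ?z w - of_real (- x\<^sup>2 / 2)) \<longlongrightarrow> 0) at_top"
    by (rule Lim_null_comparison)
  then have "((\<lambda>w. exp (?z w)) \<longlongrightarrow> exp (of_real (- x\<^sup>2 / 2))) at_top"
    by (intro tendsto_exp) (rule LIM_zero_cancel)
  moreover have "\<forall>\<^sub>F w in at_top. central_integrand w x = exp (?z w)"
  proof -
    have "\<forall>\<^sub>F w::real in at_top. \<bar>x\<bar> \<le> exp (- 2) * w / 2"
      by real_asymp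
    then show ?thesis using eventually_ge_at_top[of 1]
    proof eventually_elim
      case (elim w)
      have "\<bar>x\<bar> \<le> exp (- 2) * w / 2" by (fact elim)
      also have "\<dots> = exp (- 2) * w ^ 6 / (2 * w ^ 5)"
        using elim by (simp add: eval_nat_numeral)
      also have "\<dots> \<le> sqrt (L 2 (1 / w ^ 4)) / (2 * w ^ 5)"
        using elim by (intro divide_right_mono sqrt_L_2_ge) auto
      finally show ?case using elim by (simp add: central_integrand_def)
    qed
  qed
  ultimately show ?thesis
    by (simp only: tendsto_cong exp_of_real)
qed

text \<open>\<open>Re_H_le_inner\<close> after rescaling; the majorant no longer depends on
  \<open>w\<close>.\<close>

lemma central_integrand_bound: "\<forall>\<^sub>F w in at_top. \<forall>x. norm (central_integrand w x) \<le> exp (- x\<^sup>2 / 4)"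
  using eventually_L_3_le eventually_ge_at_top[of 1]
proof eventually_elim
  case (elim w)
  let ?\<sigma> = "sqrt (L 2 (1 / w ^ 4))"
  have \<sigma>_pos: "?\<sigma> > 0" using elim by (intro sqrt_L_2_pos)
  show ?case
  proof
    fix x
    show "norm (central_integrand w x) \<le> exp (- x\<^sup>2 / 4)"
    proof (cases "\<bar>x\<bar> \<le> ?\<sigma> / (2 * w ^ 5)")
      case True
      then have "\<bar>x / ?\<sigma>\<bar> \<le> 1 / (2 * w ^ 5)"
        using \<sigma>_pos by (simp add: field_simps)
      then have "Re (H (1 / w ^ 4) (x / ?\<sigma>)) \<le> - (L 2 (1 / w ^ 4) * (x / ?\<sigma>)\<^sup>2 / 4)"
        using elim by (intro Re_H_le_inner)
      also have "\<dots> = - x\<^sup>2 / 4"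
        using \<sigma>_pos by (simp add: power_divide)
      finally show ?thesis using True by (simp add: central_integrand_def)
    qed (simp add: central_integrand_def)
  qed
qed

lemma integral_central_integrand_tendsto:
  "((\<lambda>w. LINT x|lborel. central_integrand w x) \<longlongrightarrow> of_real (sqrt (2 * pi))) at_top"
proof -
  have "((\<lambda>w. LINT x|lborel. central_integrand w x) \<longlongrightarrow> (LINT x|lborel. complex_of_real (exp (- x\<^sup>2 / 2)))) at_top"
  proof (rule integral_dominated_convergence_at_top)
    show "\<forall>\<^sub>F w in at_top. AE x in lborel. norm (central_integrand w x) \<le> exp (- x\<^sup>2 / 4)"
      using central_integrand_bound by eventually_elim auto
  qed (use central_integrand_measurable central_integrand_tendsto integrable_exp_minus_square_quarter in auto)
  then show ?thesis
    by (simp only: integral_complex_of_real integral_exp_minus_square_half)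
qed

text \<open>The circle is split at \<open>\<bar>t\<bar> = d\<close>. The substitution
  \<open>t = x / \<sigma>\<close> turns the inner part into the central integral; the outer part is
  at most the length \<open>2 * pi\<close> times the bound of \<open>Re_H_le_outer\<close>.\<close>

lemma J_decomp:
  assumes "w \<ge> 1"
  shows "norm (of_real (sqrt (L 2 (1 / w ^ 4))) * J (1 / w ^ 4) - (LINT x|lborel. central_integrand w x))
    \<le> sqrt (L 2 (1 / w ^ 4)) * (2 * pi * exp (- (w\<^sup>2 / 50)))"
proof -
  define s where "s = 1 / w ^ 4"
  define \<sigma> where "\<sigma> = sqrt (L 2 s)"
  define d where "d = 1 / (2 * w ^ 5)"
  define f where "f = (\<lambda>t. exp (H s t))"
  have s: "s > 0" using assms by (simp add: s_def)
  have \<sigma>_pos: "\<sigma> > 0" unfolding \<sigma>_def s_def by (rule sqrt_L_2_pos[OF assms])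
  have d: "0 < d" "d \<le> pi"
  proof -
    have "w ^ 5 \<ge> 1" using assms by simp
    then have "2 * w ^ 5 \<ge> 1" by linarith
    then have "d \<le> 1" unfolding d_def by (subst divide_le_eq_1_pos) linarith+
    then show "d \<le> pi" using pi_gt3 by linarith
    show "0 < d" using assms by (simp add: d_def)
  qed
  have cont: "continuous_on A f" for A
    unfolding f_def by (intro continuous_intros continuous_H s)
  have int: "set_integrable lborel {a..b} f" for a b
    by (intro borel_integrable_atLeastAtMost' cont)
  have int_out: "set_integrable lborel ({-pi..pi} - {-d..d}) f"
    by (rule set_integrable_subset[OF int[of "-pi" pi]]) auto
  have "J s = (LINT t:{-d..d} \<union> ({-pi..pi} - {-d..d})|lborel. f t)"
  proof -
    have "{-pi..pi} = {-d..d} \<union> ({-pi..pi} - {-d..d})" using d by auto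
    then show ?thesis unfolding J_def f_def by (rule arg_cong)
  qed
  also have "\<dots> = (LINT t:{-d..d}|lborel. f t) + (LINT t:({-pi..pi} - {-d..d})|lborel. f t)"
    by (rule set_integral_Un) (use int int_out in auto)
  finally have J: "J s = (LINT t:{-d..d}|lborel. f t) + (LINT t:({-pi..pi} - {-d..d})|lborel. f t)" .
  have "(LINT t:{-d..d}|lborel. f t) = \<bar>1 / \<sigma>\<bar> *\<^sub>R
      (LINT x|lborel. indicator {-d..d} (0 + 1 / \<sigma> * x) *\<^sub>R f (0 + 1 / \<sigma> * x))"
    unfolding set_lebesgue_integral_def using \<sigma>_pos by (intro lborel_integral_real_affine) simp
  also have "(\<lambda>x. indicator {-d..d} (0 + 1 / \<sigma> * x) *\<^sub>R f (0 + 1 / \<sigma> * x)) = central_integrand w"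
  proof
    fix x
    have "(0 + 1 / \<sigma> * x \<in> {-d..d}) \<longleftrightarrow> \<bar>x\<bar> \<le> \<sigma> / (2 * w ^ 5)"
      using \<sigma>_pos assms by (auto simp: d_def field_simps abs_le_iff)
    then show "indicator {-d..d} (0 + 1 / \<sigma> * x) *\<^sub>R f (0 + 1 / \<sigma> * x) = central_integrand w x"
      using assms by (simp add: central_integrand_def f_def indicator_def flip: s_def \<sigma>_def)
  qed
  finally have "of_real \<sigma> * (LINT t:{-d..d}|lborel. f t) = (LINT x|lborel. central_integrand w x)"
    using \<sigma>_pos by (simp add: scaleR_conv_of_real)
  then have "of_real \<sigma> * J s - (LINT x|lborel. central_integrand w x) =
      of_real \<sigma> * (LINT t:({-pi..pi} - {-d..d})|lborel. f t)"
    unfolding J by (simp add: algebra_simps)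
  moreover have "norm (LINT t:({-pi..pi} - {-d..d})|lborel. f t) \<le> 2 * pi * exp (- (w\<^sup>2 / 50))"
  proof -
    have "norm (LINT t:({-pi..pi} - {-d..d})|lborel. f t) \<le>
        (LINT t:({-pi..pi} - {-d..d})|lborel. norm (f t))"
      by (rule set_integral_norm_bound[OF int_out])
    also have "\<dots> \<le> (LINT t:{-pi..pi}|lborel. exp (- (w\<^sup>2 / 50)))"
      unfolding set_lebesgue_integral_def
    proof (rule integral_mono)
      show "integrable lborel (\<lambda>t. indicator ({-pi..pi} - {-d..d}) t *\<^sub>R norm (f t))"
        using set_integrable_norm[OF int_out] by (simp add: set_integrable_def)
      show "integrable lborel (\<lambda>t. indicator {-pi..pi} t *\<^sub>R exp (- (w\<^sup>2 / 50)))"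
        by simp
      show "indicator ({-pi..pi} - {-d..d}) t *\<^sub>R norm (f t) \<le> indicator {-pi..pi} t *\<^sub>R exp (- (w\<^sup>2 / 50))" for t
      proof (cases "t \<in> {-pi..pi} - {-d..d}")
        case True
        then have "Re (H s t) \<le> - (w\<^sup>2 / 50)"
          using assms unfolding s_def by (intro Re_H_le_outer) (auto simp: d_def)
        then show ?thesis using True by (simp add: f_def)
      qed (simp add: indicator_def)
    qed
    also have "\<dots> = 2 * pi * exp (- (w\<^sup>2 / 50))"
      by (simp add: set_lebesgue_integral_def)
    finally show ?thesis .
  qed
  ultimately show ?thesis
    using \<sigma>_pos by (simp add: norm_mult flip: s_def \<sigma>_def)
qed

lemma J_tendsto:
  "((\<lambda>w. of_real (sqrt (L 2 (1 / w ^ 4))) * J (1 / w ^ 4)) \<longlongrightarrow> of_real (sqrt (2 * pi))) at_top"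
proof -
  let ?D = "\<lambda>w. of_real (sqrt (L 2 (1 / w ^ 4))) * J (1 / w ^ 4) - (LINT x|lborel. central_integrand w x)"
  have "\<forall>\<^sub>F w in at_top. norm (?D w) \<le> sqrt (fact 6 * C) * (w ^ 12 * (2 * pi * exp (- (w\<^sup>2 / 50))))"
    using eventually_ge_at_top[of 1]
  proof eventually_elim
    case (elim w)
    have "norm (?D w) \<le> sqrt (L 2 (1 / w ^ 4)) * (2 * pi * exp (- (w\<^sup>2 / 50)))"
      by (rule J_decomp[OF elim])
    also have "\<dots> \<le> (sqrt (fact 6 * C) * w ^ 12) * (2 * pi * exp (- (w\<^sup>2 / 50)))"
      using elim by (intro mult_right_mono sqrt_L_2_le) auto
    finally show ?case by (simp add: mult_ac)
  qed
  moreover have "((\<lambda>w::real. sqrt (fact 6 * C) * (w ^ 12 * (2 * pi * exp (- (w\<^sup>2 / 50))))) \<longlongrightarrow>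
      sqrt (fact 6 * C) * 0) at_top"
    by (intro tendsto_mult tendsto_const) real_asymp
  ultimately have "(?D \<longlongrightarrow> 0) at_top"
    by (auto elim: Lim_null_comparison)
  from tendsto_add[OF this integral_central_integrand_tendsto] show ?thesis by simp
qed

text \<open>By \<open>J_eq\<close> the quotient equals
  \<open>sqrt (L 2 s) * J s / sqrt (2 * pi)\<close> at \<open>s = s n\<close>, and
  \<open>J_tendsto\<close> applies since \<open>s n\<close> tends to 0 from the right.\<close>

theorem saddle_point_asymptotics:
  fixes s p :: "nat \<Rightarrow> real"
  assumes p_0: "p 0 = 1"
    and p_Suc: "\<And>n. real (Suc n) * p (Suc n) = (\<Sum>i\<le>n. real (Suc i) * b (Suc i) * p (n - i))"
    and s_pos: "\<forall>\<^sub>F n in sequentially. s n > 0 \<and> L 1 (s n) = real n"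
    and s_lim: "s \<longlonglongrightarrow> 0"
  shows "(\<lambda>n. p n / (1 / sqrt (2 * pi * L 2 (s n)) * exp (L 0 (s n) + real n * s n))) \<longlonglongrightarrow> 1"
proof -
  \<comment> \<open>Chosen so that \<open>1 / w n ^ 4 = s n\<close> whenever \<open>s n\<close> is
    positive.\<close>
  define w where "w = (\<lambda>n. s n powr (- (1/4)))"
  have "filterlim s (at_right 0) sequentially"
    using s_lim s_pos by (auto simp: filterlim_at elim: eventually_mono)
  moreover have "filterlim (\<lambda>x::real. x powr (- (1/4))) at_top (at_right 0)"
    by real_asymp
  ultimately have "filterlim w at_top sequentially"
    unfolding w_def by (rule filterlim_compose[rotated])
  from filterlim_compose[OF J_tendsto this]
  have "(\<lambda>n. of_real (sqrt (L 2 (1 / w n ^ 4))) * J (1 / w n ^ 4)) \<longlonglongrightarrow> of_real (sqrt (2 * pi))" .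
  then have lim: "(\<lambda>n. Re (of_real (sqrt (L 2 (1 / w n ^ 4))) * J (1 / w n ^ 4)) / sqrt (2 * pi))
      \<longlonglongrightarrow> Re (of_real (sqrt (2 * pi))) / sqrt (2 * pi)"
    by (intro tendsto_divide tendsto_Re tendsto_const) auto
  have "\<forall>\<^sub>F n in sequentially. Re (of_real (sqrt (L 2 (1 / w n ^ 4))) * J (1 / w n ^ 4)) / sqrt (2 * pi) =
      p n / (1 / sqrt (2 * pi * L 2 (s n)) * exp (L 0 (s n) + real n * s n))"
    using s_pos
  proof eventually_elim
    case (elim n)
    have "w n ^ 4 = 1 / s n"
    proof -
      have "w n ^ 4 = s n powr (- 1)"
        using elim by (simp add: w_def powr_power)
      then show ?thesis using elim by (simp add: powr_minus_divide)
    qed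
    then have s: "1 / w n ^ 4 = s n" by simp
    have "J (s n) = of_real (2 * pi * p n * exp (- L 0 (s n) - real n * s n))"
      using elim coeff_E_unique[OF p_0 p_Suc] by (simp add: J_eq)
    then have "Re (of_real (sqrt (L 2 (s n))) * J (s n)) / sqrt (2 * pi) =
        sqrt (L 2 (s n)) * (2 * pi) * p n * exp (- L 0 (s n) - real n * s n) / sqrt (2 * pi)"
      by simp
    also have "\<dots> = p n * (sqrt (2 * pi) * sqrt (L 2 (s n))) * exp (- (L 0 (s n) + real n * s n))"
    proof -
      have "2 * pi / sqrt (2 * pi) = sqrt (2 * pi)"
        by (intro real_div_sqrt) simp
      moreover have "- L 0 (s n) - real n * s n = - (L 0 (s n) + real n * s n)"
        by simp
      moreover have "sqrt (L 2 (s n)) * (2 * pi) * p n * e / sqrt (2 * pi) =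
          p n * ((2 * pi / sqrt (2 * pi)) * sqrt (L 2 (s n))) * e" for e
        by simp
      ultimately show ?thesis by simp
    qed
    also have "\<dots> = p n / (1 / sqrt (2 * pi * L 2 (s n)) * exp (L 0 (s n) + real n * s n))"
      by (simp only: exp_minus real_sqrt_mult) (simp add: divide_inverse mult_ac)
    finally show ?case unfolding s .
  qed
  from Lim_transform_eventually[OF lim this] show ?thesis by simp
qed

section \<open>Existence, uniqueness and limit of the saddle point\<close>

lemma L_1_strict_antimono:
  assumes "0 < s" "s < s'"
  shows "L 1 s' < L 1 s"
proof -
  let ?f = "\<lambda>s k. real k ^ 1 * b k * exp (- real k * s)"
  have sum: "summable (?f s)" "summable (?f s')"
    by (rule summable_L, use assms in linarith)+
  have "0 < (\<Sum>k. ?f s k - ?f s' k)"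
  \<comment> \<open>The term of index 1 supplies strictness; the term of index 0 vanishes.\<close>
  proof (rule suminf_pos2[of _ 1])
    show "summable (\<lambda>k. ?f s k - ?f s' k)"
      by (intro summable_diff sum)
    show "0 \<le> ?f s k - ?f s' k" for k
      using assms b_nonneg[of k] by (auto intro!: mult_left_mono)
    show "0 < ?f s 1 - ?f s' 1"
      using assms b_ge[of 1] by simp
  qed
  also have "\<dots> = L 1 s - L 1 s'"
    unfolding L_def by (rule suminf_diff[OF sum, symmetric])
  finally show ?thesis by simp
qed

text \<open>A power series in \<open>exp (- x)\<close>, which converges at the larger point
  \<open>exp (- (s / 2))\<close> and is therefore continuous at \<open>exp (- s)\<close>.\<close>

lemma continuous_L_1:
  assumes "s > 0"
  shows "isCont (L 1) s"
proof -
  have eq: "real k ^ 1 * b k * exp (- real k * x) = real k * b k * exp (- x) ^ k" for k x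
    by (simp flip: exp_of_nat_mult)
  have "summable (\<lambda>k. real k * b k * exp (- (s / 2)) ^ k)"
    using summable_L[of "s / 2" 1] assms unfolding eq by simp
  then have "isCont (\<lambda>x. \<Sum>k. real k * b k * x ^ k) (exp (- s))"
    by (rule isCont_powser) (use assms in simp)
  then have "isCont (\<lambda>x. \<Sum>k. real k * b k * exp (- x) ^ k) s"
    by (rule isCont_o2[where f = "\<lambda>x. exp (- x)" and a = s, rotated]) (intro continuous_intros)
  then show ?thesis
    unfolding L_def[abs_def] eq .
qed

lemma ex1_L_1_eq:
  assumes "n \<ge> 1"
  shows "\<exists>!s. s > 0 \<and> L 1 s = real n"
proof -
  \<comment> \<open>At \<open>1 / N\<close> each of the first \<open>N\<close> terms is at least
    \<open>exp (- 1) \<ge> 1 / 3\<close>, so \<open>3 * n\<close> of them reach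
    \<open>n\<close>.\<close>
  define N where "N = 3 * n"
  have N: "N > 0" using assms by (simp add: N_def)
  have "real n \<le> real N * exp (- 1)"
    using mult_left_mono[OF exp_le, of "real n"] by (simp add: N_def exp_minus field_simps)
  also have "\<dots> = (\<Sum>k\<in>{1..N}. 1 * 1 * exp (- 1))" by simp
  also have "\<dots> \<le> (\<Sum>k\<in>{1..N}. real k ^ 1 * b k * exp (- real k * (1 / real N)))"
    using b_ge b_nonneg by (intro sum_mono mult_mono) auto
  also have "\<dots> \<le> L 1 (1 / real N)"
    unfolding L_def by (intro sum_le_suminf summable_L ballI L_term_nonneg) (use N in auto)
  finally have lower: "real n \<le> L 1 (1 / real N)" .
  \<comment> \<open>Large enough for the upper bound \<open>fact 5 * C / s\<close> to be at most
    1.\<close>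
  define s where "s = 1 + fact 5 * C"
  have s: "s \<ge> 1" using C_nonneg by (simp add: s_def)
  have "L 1 s \<le> fact 5 / s ^ 5 * C"
    using L_le[of s 1] s by simp
  also have "\<dots> \<le> fact 5 / s ^ 1 * C"
    using s C_nonneg by (intro mult_right_mono divide_left_mono power_increasing) auto
  also have "\<dots> \<le> 1"
    using s s_def by (simp add: pos_divide_le_eq)
  also have "\<dots> \<le> real n" using assms by simp
  finally have upper: "L 1 s \<le> real n" .
  have "1 / real N \<le> 1" using N by simp
  with s have "1 / real N \<le> s" by linarith
  then have "\<exists>x. 1 / real N \<le> x \<and> x \<le> s \<and> L 1 x = real n"
    using N lower upper
    by (intro IVT2 allI impI continuous_L_1) (auto intro: less_le_trans[of 0 "1 / real N"])
  then obtain x where "1 / real N \<le> x" "L 1 x = real n" by blast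
  moreover have "0 < 1 / real N" using N by simp
  ultimately have "x > 0 \<and> L 1 x = real n" by linarith
  moreover have "y = x" if "y > 0 \<and> L 1 y = real n" "x > 0 \<and> L 1 x = real n" for x y
    using that L_1_strict_antimono[of x y] L_1_strict_antimono[of y x] by (cases x y rule: linorder_cases) auto
  ultimately show ?thesis by blast
qed

text \<open>For fixed \<open>e\<close> the value \<open>L 1 e\<close> is eventually below
  \<open>n = L 1 (s n)\<close>, and \<open>L 1\<close> decreases strictly.\<close>

lemma L_1_eq_imp_tendsto_0:
  assumes "\<forall>\<^sub>F n in sequentially. s n > 0 \<and> L 1 (s n) = real n"
  shows "s \<longlonglongrightarrow> 0"
proof (rule order_tendstoI)
  fix e :: real assume e: "e > 0"
  have "\<forall>\<^sub>F n in sequentially. L 1 e < real n"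
    using filterlim_real_sequentially by (simp add: filterlim_at_top_dense)
  with assms show "\<forall>\<^sub>F n in sequentially. s n < e"
  proof eventually_elim
    case (elim n)
    then show ?case
      using L_1_strict_antimono[OF e, of "s n"] by (cases "s n" e rule: linorder_cases) auto
  qed
qed (use assms in \<open>auto elim: eventually_mono\<close>)

end

section \<open>Generalized partitions\<close>

text \<open>Elements are kept apart from their weights, so that different pairs with the same
  product count as different parts.\<close>

definition weighted_multisets :: "('a \<Rightarrow> nat) \<Rightarrow> 'a set \<Rightarrow> nat \<Rightarrow> 'a multiset set" where
  "weighted_multisets f A n = {P. set_mset P \<subseteq> A \<and> (\<Sum>x\<in>#P. f x) = n}"

text \<open>Either \<open>a\<close> does not occur, or one copy of it can be removed.\<close>

lemma weighted_multisets_insert: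
  "weighted_multisets f (insert a A) n = weighted_multisets f A n \<union>
    (if f a \<le> n then add_mset a ` weighted_multisets f (insert a A) (n - f a) else {})"
proof (intro equalityI subsetI)
  fix P assume P: "P \<in> weighted_multisets f (insert a A) n"
  show "P \<in> weighted_multisets f A n \<union>
    (if f a \<le> n then add_mset a ` weighted_multisets f (insert a A) (n - f a) else {})"
  proof (cases "a \<in># P")
    case True
    then obtain Q where "P = add_mset a Q" by (metis mset_add)
    then show ?thesis using P by (auto simp: weighted_multisets_def)
  qed (use P in \<open>auto simp: weighted_multisets_def\<close>)
qed (auto simp: weighted_multisets_def split: if_splits)

lemma finite_weighted_multisets:
  assumes "finite A" "\<And>x. x \<in> A \<Longrightarrow> f x > 0"
  shows "finite (weighted_multisets f A n)"
  using assms
proof (induction A arbitrary: n rule: finite_induct)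
  case empty
  then show ?case by (auto simp: weighted_multisets_def intro: finite_subset[of _ "{{#}}"])
next
  case (insert a A)
  show ?case
  proof (induction n rule: less_induct)
    case (less n)
    have "finite (weighted_multisets f A n)" "f a > 0"
      using insert by auto
    then show ?case
      using less[of "n - f a"] by (subst weighted_multisets_insert) auto
  qed
qed

lemma fps_one_minus_X_power_inverse:
  fixes m :: nat
  assumes "m > 0"
  shows "(1 - fps_X ^ m) * inverse (1 - fps_X ^ m) = (1 :: real fps)"
  using assms by (subst mult.commute) (rule inverse_mult_eq_1, simp)

text \<open>By \<open>weighted_multisets_insert\<close>, multiplying the series for
  \<open>insert a A\<close> by \<open>1 - fps_X ^ f a\<close> gives the series for
  \<open>A\<close>.\<close>

lemma fps_weighted_multisets:
  assumes "finite A" "\<And>x. x \<in> A \<Longrightarrow> f x > 0"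
  shows "Abs_fps (\<lambda>n. real (card (weighted_multisets f A n))) = (\<Prod>x\<in>A. inverse (1 - fps_X ^ f x))"
  using assms
proof (induction A rule: finite_induct)
  case empty
  have "weighted_multisets f {} n = (if n = 0 then {{#}} else {})" for n
    by (auto simp: weighted_multisets_def)
  then show ?case by (intro fps_ext) auto
next
  case (insert a A)
  let ?F = "\<lambda>A. Abs_fps (\<lambda>n. real (card (weighted_multisets f A n)))"
  have fa: "f a > 0" using insert by simp
  have card: "card (weighted_multisets f (insert a A) n) = card (weighted_multisets f A n) +
      (if f a \<le> n then card (weighted_multisets f (insert a A) (n - f a)) else 0)" for n
  proof -
    have "weighted_multisets f A n \<inter> add_mset a ` weighted_multisets f (insert a A) (n - f a) = {}"
    proof (rule Int_emptyI)
      fix P assume P: "P \<in> weighted_multisets f A n"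
        and "P \<in> add_mset a ` weighted_multisets f (insert a A) (n - f a)"
      then have "a \<in># P" by (metis imageE union_single_eq_member)
      moreover have "set_mset P \<subseteq> A" using P by (simp add: weighted_multisets_def)
      ultimately show False using insert.hyps by blast
    qed
    moreover have "finite (weighted_multisets f A n)" "finite (weighted_multisets f (insert a A) (n - f a))"
      using insert by (auto intro!: finite_weighted_multisets)
    moreover have "card (add_mset a ` B) = card B" for B :: "'a multiset set"
      by (intro card_image) (auto simp: inj_on_def)
    ultimately show ?thesis
      by (subst weighted_multisets_insert) (auto simp: card_Un_disjoint)
  qed
  have "?F (insert a A) * (1 - fps_X ^ f a) = ?F A"
  proof (rule fps_ext)
    fix n
    have "fps_nth (?F (insert a A) * (1 - fps_X ^ f a)) n =
        real (card (weighted_multisets f (insert a A) n)) -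
        (if n < f a then 0 else real (card (weighted_multisets f (insert a A) (n - f a))))"
      by (simp add: right_diff_distrib fps_X_power_mult_right_nth)
    also have "\<dots> = fps_nth (?F A) n"
      by (subst card) auto
    finally show "fps_nth (?F (insert a A) * (1 - fps_X ^ f a)) n = fps_nth (?F A) n" .
  qed
  then have "?F (insert a A) * ((1 - fps_X ^ f a) * inverse (1 - fps_X ^ f a)) =
      ?F A * inverse (1 - fps_X ^ f a)"
    by (simp flip: mult.assoc)
  then show ?case
    using insert fa by (simp add: fps_one_minus_X_power_inverse mult.commute)
qed

section \<open>The logarithmic derivative of the generating product\<close>

lemma fps_nth_inverse_one_minus_X_power:
  assumes "m > 0"
  shows "fps_nth (inverse (1 - fps_X ^ m)) k = (if m dvd k then 1 else 0 :: real)"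
proof -
  define D where "D = Abs_fps (\<lambda>k. if m dvd k then 1 else 0 :: real)"
  have "D * (1 - fps_X ^ m) = 1"
  proof (rule fps_ext)
    fix k
    show "fps_nth (D * (1 - fps_X ^ m)) k = fps_nth 1 k"
    proof (cases "k < m")
      case True
      then show ?thesis
        by (auto simp: D_def right_diff_distrib fps_X_power_mult_right_nth dest: dvd_imp_le)
    next
      case False
      then show ?thesis using assms
        by (auto simp: D_def right_diff_distrib fps_X_power_mult_right_nth dvd_minus_self)
    qed
  qed
  then have "D * ((1 - fps_X ^ m) * inverse (1 - fps_X ^ m)) = inverse (1 - fps_X ^ m)"
    by (simp flip: mult.assoc)
  then have "inverse (1 - fps_X ^ m) = D"
    using fps_one_minus_X_power_inverse[OF assms] by simp
  then show ?thesis by (simp add: D_def)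
qed

text \<open>Product rule: each factor contributes its own logarithmic derivative.\<close>

lemma fps_deriv_prod_inverse_one_minus_X_power:
  assumes "finite A" "\<And>x. x \<in> A \<Longrightarrow> f x > 0"
  shows "fps_deriv (\<Prod>x\<in>A. inverse (1 - fps_X ^ f x)) =
    (\<Sum>x\<in>A. of_nat (f x) * fps_X ^ (f x - 1) * inverse (1 - fps_X ^ f x)) *
    (\<Prod>x\<in>A. inverse (1 - fps_X ^ f x) :: real fps)"
  using assms
proof (induction A rule: finite_induct)
  case (insert a A)
  have "f a > 0" using insert by simp
  then have "fps_deriv (inverse (1 - fps_X ^ f a)) =
      of_nat (f a) * fps_X ^ (f a - 1) * inverse (1 - fps_X ^ f a) * (inverse (1 - fps_X ^ f a) :: real fps)"
    by (subst fps_inverse_deriv) (simp_all add: fps_deriv_power power2_eq_square mult_ac fps_of_nat)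
  then show ?case
    using insert by (simp add: algebra_simps)
qed simp

section \<open>Pairs of positive integers, graded by their product\<close>

text \<open>The truncation at \<open>N\<close> makes the set finite and still admits every part of a
  generalized partition of \<open>n \<le> N\<close>.\<close>

definition parts :: "nat \<Rightarrow> (nat \<times> nat) set" where
  "parts N = {(v, w). v > 0 \<and> w > 0 \<and> v * w \<le> N}"

definition weight :: "nat \<times> nat \<Rightarrow> nat" where
  "weight = (\<lambda>(v, w). v * w)"

lemma finite_parts: "finite (parts N)"
proof (rule finite_subset)
  show "parts N \<subseteq> {..N} \<times> {..N}"
  proof
    fix x assume "x \<in> parts N"
    then obtain v w where x: "x = (v, w)" "v > 0" "w > 0" "v * w \<le> N"
      by (auto simp: parts_def)
    then have "v \<le> v * w" "w \<le> v * w" by simp_all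
    then have "v \<le> N" "w \<le> N" using x by linarith+
    then show "x \<in> {..N} \<times> {..N}" using x by simp
  qed
qed auto

lemma weight_pos: "x \<in> parts N \<Longrightarrow> weight x > 0"
  by (auto simp: parts_def weight_def)

text \<open>A pair of product \<open>m\<close> is determined by its first entry, which can be any
  divisor of \<open>m\<close>. This is where the exponent \<open>d(m)\<close> comes from.\<close>

lemma card_parts_of_weight:
  assumes "0 < m" "m \<le> N"
  shows "card {x \<in> parts N. weight x = m} = num_divisors m"
proof -
  have "bij_betw fst {x \<in> parts N. weight x = m} {k. k dvd m}"
    by (rule bij_betw_byWitness[where f' = "\<lambda>v. (v, m div v)"])
       (use assms in \<open>auto simp: parts_def weight_def intro!: Nat.gr0I\<close>)
  then show ?thesis unfolding num_divisors_def by (rule bij_betw_same_card)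
qed

lemma prod_parts:
  fixes g :: "nat \<Rightarrow> 'b :: comm_monoid_mult"
  shows "(\<Prod>x\<in>parts N. g (weight x)) = (\<Prod>i<N. g (Suc i) ^ num_divisors (Suc i))"
proof -
  have "(\<Prod>x\<in>parts N. g (weight x)) = (\<Prod>m\<in>{1..N}. \<Prod>x\<in>{x \<in> parts N. weight x = m}. g (weight x))"
    by (rule prod.group[symmetric]) (use finite_parts[of N] in \<open>auto simp: parts_def weight_def\<close>)
  also have "\<dots> = (\<Prod>m\<in>{1..N}. g m ^ num_divisors m)"
    by (intro prod.cong) (auto simp: card_parts_of_weight)
  also have "\<dots> = (\<Prod>i<N. g (Suc i) ^ num_divisors (Suc i))"
    by (rule prod.reindex_bij_witness[of _ Suc "\<lambda>m. m - 1"]) auto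
  finally show ?thesis .
qed

lemma sum_parts_dvd:
  assumes "0 < k" "k \<le> N"
  shows "(\<Sum>x\<in>parts N. if weight x dvd k then real (weight x) else 0) =
    (\<Sum>l | l dvd k. real l * real (num_divisors l))"
proof -
  have "(\<Sum>x\<in>parts N. if weight x dvd k then real (weight x) else 0) =
      (\<Sum>m\<in>{1..N}. \<Sum>x\<in>{x \<in> parts N. weight x = m}. if weight x dvd k then real (weight x) else 0)"
    by (rule sum.group[symmetric]) (use finite_parts[of N] in \<open>auto simp: parts_def weight_def\<close>)
  also have "\<dots> = (\<Sum>m\<in>{1..N}. if m dvd k then real m * real (num_divisors m) else 0)"
    by (intro sum.cong) (auto simp: card_parts_of_weight)
  also have "\<dots> = (\<Sum>l | l dvd k. real l * real (num_divisors l))"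
  proof (intro sum.mono_neutral_cong_right)
    show "{l. l dvd k} \<subseteq> {1..N}"
    proof
      fix l assume "l \<in> {l. l dvd k}"
      then have "l \<le> k" "l > 0" using assms by (auto intro: dvd_imp_le dvd_pos_nat)
      then show "l \<in> {1..N}" using assms by simp
    qed
  qed auto
  finally show ?thesis .
qed

text \<open>Unlike \<open>generalized_partitions\<close>, this admits the empty multiset, so the
  value at 0 is 1, the constant coefficient of the product.\<close>

definition gp_count :: "nat \<Rightarrow> nat" where
  "gp_count n = card (weighted_multisets weight (parts n) n)"

text \<open>No part weighs more than the total \<open>n\<close>, so the truncation at
  \<open>N\<close> excludes nothing.\<close>

lemma weighted_multisets_parts_eq:
  assumes "n \<le> N"
  shows "weighted_multisets weight (parts N) n =
    {P. (\<forall>(v, w)\<in>#P. v > 0 \<and> w > 0) \<and> (\<Sum>(v, w)\<in>#P. v * w) = n}"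
proof -
  have "weight x \<le> (\<Sum>x\<in>#P. weight x)" if "x \<in># P" for x P
    using that by (metis mset_add le_add1 image_mset_add_mset sum_mset.add_mset)
  then have "set_mset P \<subseteq> parts N"
    if "\<forall>(v, w)\<in>#P. v > 0 \<and> w > 0" "(\<Sum>x\<in>#P. weight x) = n" for P
    using that assms unfolding parts_def weight_def by fastforce
  then show ?thesis
    unfolding weighted_multisets_def weight_def[symmetric] by (auto simp: parts_def)
qed

lemma gp_count_eq: "n \<le> N \<Longrightarrow> gp_count n = card (weighted_multisets weight (parts N) n)"
  unfolding gp_count_def by (simp add: weighted_multisets_parts_eq)

lemma gp_count_0: "gp_count 0 = 1"
proof -
  have "weighted_multisets weight (parts 0) 0 = {{#}}"
    by (auto simp: weighted_multisets_def parts_def)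
  then show ?thesis by (simp add: gp_count_def)
qed

lemma gp_count_generalized_partitions:
  assumes "n \<ge> 1"
  shows "gp_count n = card (generalized_partitions n)"
proof -
  have "weighted_multisets weight (parts n) n = generalized_partitions n"
    unfolding weighted_multisets_parts_eq[OF order_refl] generalized_partitions_def using assms by auto
  then show ?thesis by (simp add: gp_count_def)
qed

lemma fps_nth_prod_parts:
  assumes "n \<le> N"
  shows "fps_nth (\<Prod>x\<in>parts N. inverse (1 - fps_X ^ weight x)) n = real (gp_count n)"
  using fps_weighted_multisets[OF finite_parts weight_pos, of N, symmetric] gp_count_eq[OF assms]
  by simp

text \<open>The coefficient of index \<open>n\<close> in the partial products is constant from
  \<open>N = n\<close> on, which is convergence in the topology of formal power series.\<close>

lemma gp_coeff_eq: "gp_coeff n = real (gp_count n)"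
proof -
  let ?f = "\<lambda>i. inverse ((1 - fps_X ^ Suc i) ^ num_divisors (Suc i)) :: real fps"
  have partial: "(\<Prod>i<N. ?f i) = (\<Prod>x\<in>parts N. inverse (1 - fps_X ^ weight x))" for N
    unfolding prod_parts[of "\<lambda>m. inverse (1 - fps_X ^ m)"] by (simp add: fps_inverse_power)
  have "(\<lambda>N. \<Prod>i<N. ?f i) \<longlonglongrightarrow> Abs_fps (\<lambda>n. real (gp_count n))"
  proof (rule tendsto_fpsI)
    fix n
    show "\<forall>\<^sub>F N in sequentially. fps_nth (\<Prod>i<N. ?f i) n = fps_nth (Abs_fps (\<lambda>n. real (gp_count n))) n"
      using eventually_ge_at_top[of n]
      by eventually_elim (simp only: partial fps_nth_prod_parts fps_nth_Abs_fps)
  qed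
  then have "(\<lambda>N. \<Prod>i\<le>N. ?f i) \<longlonglongrightarrow> Abs_fps (\<lambda>n. real (gp_count n))"
    by (simp only: LIMSEQ_lessThan_iff_atMost)
  \<comment> \<open>A raw infinite product is required to have a nonzero limit.\<close>
  moreover have "Abs_fps (\<lambda>n. real (gp_count n)) \<noteq> 0"
    using gp_count_0 by (auto simp: fps_eq_iff intro!: exI[of _ 0])
  ultimately have "?f has_prod Abs_fps (\<lambda>n. real (gp_count n))"
    by (simp add: has_prod_def raw_has_prod_def)
  from has_prod_unique[OF this] show ?thesis
    unfolding gp_coeff_def gp_series_def by (metis fps_nth_Abs_fps)
qed

text \<open>Coefficient \<open>n\<close> of \<open>Q' = D * Q\<close> for the product over
  \<open>parts (Suc n)\<close>, which is long enough to have the correct coefficients up to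
  \<open>Suc n\<close>.\<close>

lemma gp_coeff_Suc:
  "real (Suc n) * gp_coeff (Suc n) =
    (\<Sum>i\<le>n. (\<Sum>l | l dvd Suc i. real l * real (num_divisors l)) * gp_coeff (n - i))"
proof -
  define Q where "Q = (\<Prod>x\<in>parts (Suc n). inverse (1 - fps_X ^ weight x) :: real fps)"
  define D where "D = (\<Sum>x\<in>parts (Suc n). of_nat (weight x) * fps_X ^ (weight x - 1) *
    inverse (1 - fps_X ^ weight x) :: real fps)"
  have Q: "fps_nth Q k = gp_coeff k" if "k \<le> Suc n" for k
    using that by (simp add: Q_def fps_nth_prod_parts gp_coeff_eq)
  \<comment> \<open>Because of the factor \<open>fps_X ^ (m - 1)\<close>, index \<open>i\<close>
    belongs to the multiple \<open>Suc i\<close> of \<open>m\<close>.\<close>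
  have summand: "fps_nth (of_nat m * fps_X ^ (m - 1) * inverse (1 - fps_X ^ m)) i =
      (if m dvd Suc i then real m else 0)" if "m > 0" for m i
  proof -
    have "fps_nth (of_nat m * fps_X ^ (m - 1) * inverse (1 - fps_X ^ m)) i =
        real m * (if i < m - 1 then 0 else if m dvd i - (m - 1) then 1 else 0)"
      using that
      by (simp add: mult.assoc fps_mult_of_nat_nth fps_X_power_mult_nth fps_nth_inverse_one_minus_X_power)
    also have "\<dots> = (if m dvd Suc i then real m else 0)"
    proof (cases "i < m - 1")
      case True
      then have "\<not> m dvd Suc i" by (auto dest: dvd_imp_le)
      then show ?thesis using True by simp
    next
      case False
      then have "i - (m - 1) = Suc i - m" "m \<le> Suc i" using that by auto
      then show ?thesis using False by (simp add: dvd_minus_self)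
    qed
    finally show ?thesis .
  qed
  have D: "fps_nth D i = (\<Sum>l | l dvd Suc i. real l * real (num_divisors l))" if "i \<le> n" for i
  proof -
    have "fps_nth D i = (\<Sum>x\<in>parts (Suc n). if weight x dvd Suc i then real (weight x) else 0)"
      unfolding D_def fps_sum_nth by (intro sum.cong refl summand weight_pos)
    also have "\<dots> = (\<Sum>l | l dvd Suc i. real l * real (num_divisors l))"
      using that by (intro sum_parts_dvd) auto
    finally show ?thesis .
  qed
  have "fps_deriv Q = D * Q"
    unfolding Q_def D_def by (intro fps_deriv_prod_inverse_one_minus_X_power finite_parts weight_pos)
  then have "fps_nth (fps_deriv Q) n = fps_nth (D * Q) n" by simp
  then show ?thesis
    by (simp add: fps_mult_nth Q D atLeast0AtMost)
qed

section \<open>Application to the divisor function\<close>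

text \<open>The coefficient \<open>b\<^sub>k\<close> of \<open>log F\<close>. Division by zero gives
  the value 0 at \<open>k = 0\<close>, as the locale demands.\<close>

definition divisor_weight :: "nat \<Rightarrow> real" where
  "divisor_weight k = (\<Sum>l | l dvd k. real l * real (num_divisors l)) / real k"

lemma num_divisors_pos: "k > 0 \<Longrightarrow> num_divisors k > 0"
  unfolding num_divisors_def by (subst card_gt_0_iff) auto

lemma num_divisors_le: "num_divisors k \<le> k"
proof (cases "k = 0")
  case False
  then have "{l. l dvd k} \<subseteq> {1..k}"
    by (auto dest: dvd_imp_le intro: Suc_leI dvd_pos_nat)
  from card_mono[OF _ this] show ?thesis by (simp add: num_divisors_def)
\<comment> \<open>Every number divides 0, and \<open>card\<close> of an infinite set is 0.\<close>
qed (simp add: num_divisors_def)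

text \<open>The divisor \<open>l = k\<close> alone gives the lower bound. For the upper one, at most
  \<open>k\<close> divisors contribute at most \<open>k * k\<close> each, before division by
  \<open>k\<close>.\<close>

interpretation divisors: saddle_point_coeffs divisor_weight
proof
  show "divisor_weight 0 = 0" by (simp add: divisor_weight_def)
next
  fix k :: nat assume k: "k > 0"
  have "real k * 1 \<le> real k * real (num_divisors k)"
    using num_divisors_pos[OF k] by (intro mult_left_mono) auto
  also have "\<dots> \<le> (\<Sum>l | l dvd k. real l * real (num_divisors l))"
    using k by (intro member_le_sum) auto
  finally show "1 \<le> divisor_weight k"
    using k by (simp add: divisor_weight_def)
next
  fix k :: nat
  show "divisor_weight k \<le> real k ^ 2"
  proof (cases "k = 0")
    case False
    have "(\<Sum>l | l dvd k. real l * real (num_divisors l)) \<le> (\<Sum>l | l dvd k. real k * real k)"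
    proof (intro sum_mono mult_mono)
      fix l assume "l \<in> {l. l dvd k}"
      then have "l \<le> k" using False by (auto intro: dvd_imp_le)
      then show "real l \<le> real k" "real (num_divisors l) \<le> real k"
        using num_divisors_le[of l] by auto
    qed auto
    also have "\<dots> = real (num_divisors k) * (real k * real k)"
      by (simp add: num_divisors_def)
    also have "\<dots> \<le> real k * (real k * real k)"
      by (intro mult_right_mono) (auto simp: num_divisors_le)
    finally show ?thesis
      using False by (simp add: divisor_weight_def divide_le_eq power2_eq_square mult_ac)
  qed (simp add: divisor_weight_def)
qed

text \<open>The division by \<open>k\<close> in \<open>divisor_weight\<close> shifts the exponent by
  one, so that \<open>m = -1\<close> corresponds to \<open>j = 0\<close>. Nonnegative terms let the
  series pass to an unordered sum.\<close>

lemma S_eq_L: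
  assumes "\<omega> > 0" "m = int j - 1"
  shows "S m \<omega> = divisors.L j (1 / \<omega>)"
proof -
  let ?f = "\<lambda>k. real k ^ j * divisor_weight k * exp (- real k * (1 / \<omega>))"
  have "summable ?f"
    using assms by (intro divisors.summable_L) simp
  moreover from this have "summable (\<lambda>k. norm (?f k))"
    using divisors.L_term_nonneg[of _ j "1 / \<omega>"] by simp
  ultimately have "(?f has_sum divisors.L j (1 / \<omega>)) UNIV"
    unfolding divisors.L_def by (intro norm_summable_imp_has_sum summable_sums)
  also have "?this \<longleftrightarrow> ((\<lambda>k. \<Sum>l | l dvd k.
      real l * real (num_divisors l) * real k powi m * exp (- real k / \<omega>)) has_sum divisors.L j (1 / \<omega>)) {1..}"
  \<comment> \<open>The index sets differ only in 0, where the term of \<open>L\<close>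
    vanishes.\<close>
  proof (rule has_sum_cong_neutral)
    fix k :: nat assume "k \<in> UNIV \<inter> {1..}"
    then have "real k powi m = real k ^ j / real k"
      unfolding assms(2) by (subst power_int_diff) auto
    then show "?f k = (\<Sum>l | l dvd k.
        real l * real (num_divisors l) * real k powi m * exp (- real k / \<omega>))"
      unfolding sum_distrib_right[symmetric] by (simp add: divisor_weight_def)
  qed (auto simp: divisors.b_0 not_less_eq_eq)
  finally show ?thesis
    unfolding S_def by (rule infsumI)
qed

lemma ex1_omega:
  assumes "n \<ge> 1"
  shows "\<exists>!\<omega>. \<omega> > 0 \<and> S 0 \<omega> = real n"
proof -
  obtain s where s: "s > 0" "divisors.L 1 s = real n"
    and unique: "\<And>s'. s' > 0 \<Longrightarrow> divisors.L 1 s' = real n \<Longrightarrow> s' = s"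
    using divisors.ex1_L_1_eq[OF assms] by blast
  show ?thesis
  proof (intro ex1I conjI)
    show "1 / s > 0" "S 0 (1 / s) = real n"
      using s by (simp_all add: S_eq_L[where j = 1] del: One_nat_def)
    fix \<omega> assume "\<omega> > 0 \<and> S 0 \<omega> = real n"
    then have "1 / \<omega> = s"
      using S_eq_L[of \<omega> 0 1] by (intro unique) auto
    then show "\<omega> = 1 / s" by auto
  qed
qed

text \<open>The first conjunct identifies the coefficients with the counts, the second makes the
  description in \<open>omega\<close> well defined for \<open>n \<ge> 1\<close>; the limit then
  follows from the saddle point theorem with \<open>s = 1 / \<omega>\<close>.\<close>

theorem theorem4p7:
  shows "(\<forall>n\<ge>1. gp_coeff n = real (card (generalized_partitions n))) \<and>
    (\<forall>n\<ge>1. \<exists>!\<omega>. \<omega> > 0 \<and> S 0 \<omega> = real n) \<and>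
    (\<lambda>n. gp_coeff n /
       (1 / sqrt (2 * pi * S 1 (omega n)) * exp (S (-1) (omega n) + real n / omega n)))
    \<longlonglongrightarrow> 1"
proof (intro conjI allI impI)
  show "gp_coeff n = real (card (generalized_partitions n))" if "n \<ge> 1" for n
    using that by (simp add: gp_coeff_eq gp_count_generalized_partitions)
  show "\<exists>!\<omega>. \<omega> > 0 \<and> S 0 \<omega> = real n" if "n \<ge> 1" for n
    using that by (rule ex1_omega)
  have omega: "omega n > 0" "S 0 (omega n) = real n" if "n \<ge> 1" for n
    using theI'[OF ex1_omega[OF that]] by (auto simp: omega_def)
  define s where "s = (\<lambda>n. 1 / omega n)"
  have s: "\<forall>\<^sub>F n in sequentially. s n > 0 \<and> divisors.L 1 (s n) = real n"
    using eventually_ge_at_top[of 1]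
  proof eventually_elim
    case (elim n)
    then show ?case
      using omega[OF elim] S_eq_L[of "omega n" 0 1] by (simp add: s_def)
  qed
  have lim: "(\<lambda>n. gp_coeff n / (1 / sqrt (2 * pi * divisors.L 2 (s n)) *
      exp (divisors.L 0 (s n) + real n * s n))) \<longlonglongrightarrow> 1"
  proof (rule divisors.saddle_point_asymptotics)
    show "gp_coeff 0 = 1" by (simp add: gp_coeff_eq gp_count_0)
    show "real (Suc n) * gp_coeff (Suc n) =
        (\<Sum>i\<le>n. real (Suc i) * divisor_weight (Suc i) * gp_coeff (n - i))" for n
      unfolding gp_coeff_Suc by (intro sum.cong) (simp_all add: divisor_weight_def del: of_nat_Suc)
  qed (use s divisors.L_1_eq_imp_tendsto_0 in auto)
  show "(\<lambda>n. gp_coeff n /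
       (1 / sqrt (2 * pi * S 1 (omega n)) * exp (S (-1) (omega n) + real n / omega n)))
    \<longlonglongrightarrow> 1"
  proof (rule Lim_transform_eventually[OF lim])
    show "\<forall>\<^sub>F n in sequentially. gp_coeff n / (1 / sqrt (2 * pi * divisors.L 2 (s n)) *
        exp (divisors.L 0 (s n) + real n * s n)) = gp_coeff n /
       (1 / sqrt (2 * pi * S 1 (omega n)) * exp (S (-1) (omega n) + real n / omega n))"
      using eventually_ge_at_top[of 1]
    proof eventually_elim
      case (elim n)
      then show ?case
        using omega(1)[OF elim] S_eq_L[of "omega n" 1 2] S_eq_L[of "omega n" "-1" 0] by (simp add: s_def)
    qed
  qed
qed

end
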